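(* Let $G=(V,E)$ be a finite connected graph (parallel edges allowed, no loops), with each edge $e$ given an orientation with endpoints $e^+$ and $e^-$. Fix any vertex $q\in V$. Then \[ \frac{\kappa_2(G)}{\kappa(G)} \;=\; \frac{3}{4}\sum_{e\in E}\bigl(r(e^+,q)-r(e^-,q)\bigr)^2 \;+\; \frac14\sum_{e\in E} r(e^+,e^-)^2, \] where $\kappa(G)$ is the number of spanning trees of $G$, $\kappa_2(G)$ is the number of spanning forests of $G$ with exactly two components, and $r(x,y)$ is the effective resistance between $x$ and $y$.
   Context: The effective resistance $r(x,y)$ is computed by viewing $G$ as an electrical network with a unit resistor on each edge; equivalently $r(x,y)=(\mathbf e_x-\mathbf e_y)^{\intercal}L^{+}(\mathbf e_x-\mathbf e_y)$ where $L$ is the Laplacian matrix of $G$ ($L_{v,v}=\deg v$, $L_{v,w}=-$(number of edges between $v$ and $w$) for $v\neq w$) and $L^+$ its Moore–Penrose pseudoinverse; equivalently $r(x,y)=\kappa_2(x|y)/\kappa(G)$, where $\kappa_2(x|y)$ is the number of two-component spanning forests with $x$ and $y$ in different components. *)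

theory Defs
  imports Complex_Main "Graph_Theory.Digraph_Component"
begin

text \<open>
  A multigraph together with an orientation of its edges is a digraph with possibly parallel
  arcs: the edge \<open>e\<close> has \<open>e\<^sup>+ = head G e\<close> and \<open>e\<^sup>- = tail G e\<close>. All notions below depend only on the
  underlying undirected multigraph.

  The library predicates \<open>forest\<close>, \<open>tree\<close> and \<open>spanning_tree\<close> only exclude directed cycles, so they
  are not the undirected notions. An undirected cycle is instead a cycle in the digraph that has
  two opposite darts for every edge, subject to the restriction that it uses no edge twice
  (otherwise walking back and forth along one edge would be a cycle). Two parallel edges form a
  cycle of length 2.
\<close>

definition dart_graph :: "('a, 'b) pre_digraph \<Rightarrow> ('a, 'b \<times> bool) pre_digraph" where
  "dart_graph G =
    \<lparr>verts = verts G,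
     arcs = arcs G \<times> UNIV,
     tail = (\<lambda>(e, b). if b then tail G e else head G e),
     head = (\<lambda>(e, b). if b then head G e else tail G e)\<rparr>"

definition undirected_cycle :: "('a, 'b) pre_digraph \<Rightarrow> ('b \<times> bool) list \<Rightarrow> bool" where
  "undirected_cycle G p \<longleftrightarrow> pre_digraph.cycle (dart_graph G) p \<and> distinct (map fst p)"

definition undirected_forest :: "('a, 'b) pre_digraph \<Rightarrow> bool" where
  "undirected_forest G \<longleftrightarrow> \<not> (\<exists>p. undirected_cycle G p)"

definition graph_components :: "('a, 'b) pre_digraph \<Rightarrow> 'a set set" where
  "graph_components G = pre_digraph.sccs_verts (with_proj (mk_symmetric G))"

definition num_spanning_trees :: "('a, 'b) pre_digraph \<Rightarrow> nat" where
  "num_spanning_trees G =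
    card {T. spanning T G \<and> Digraph_Component.connected T \<and> undirected_forest T}"

definition num_spanning_2forests :: "('a, 'b) pre_digraph \<Rightarrow> nat" where
  "num_spanning_2forests G =
    card {F. spanning F G \<and> undirected_forest F \<and> card (graph_components F) = 2}"

text \<open>
  Matrices with rows and columns indexed by a finite set \<open>V\<close> are functions of two arguments, of
  which only the values on \<open>V \<times> V\<close> matter. The Moore--Penrose pseudoinverse is normalised to vanish
  off \<open>V \<times> V\<close>, so that the four Penrose equations determine it uniquely.
\<close>

definition mat_mult_on ::
    "'a set \<Rightarrow> ('a \<Rightarrow> 'a \<Rightarrow> real) \<Rightarrow> ('a \<Rightarrow> 'a \<Rightarrow> real) \<Rightarrow> 'a \<Rightarrow> 'a \<Rightarrow> real" where
  "mat_mult_on V A B = (\<lambda>u v. \<Sum>w\<in>V. A u w * B w v)"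

definition is_pseudoinverse_on ::
    "'a set \<Rightarrow> ('a \<Rightarrow> 'a \<Rightarrow> real) \<Rightarrow> ('a \<Rightarrow> 'a \<Rightarrow> real) \<Rightarrow> bool" where
  "is_pseudoinverse_on V A X \<longleftrightarrow>
    (\<forall>u v. u \<notin> V \<or> v \<notin> V \<longrightarrow> X u v = 0) \<and>
    (\<forall>u\<in>V. \<forall>v\<in>V.
      mat_mult_on V (mat_mult_on V A X) A u v = A u v \<and>
      mat_mult_on V (mat_mult_on V X A) X u v = X u v \<and>
      mat_mult_on V A X u v = mat_mult_on V A X v u \<and>
      mat_mult_on V X A u v = mat_mult_on V X A v u)"

definition pseudoinverse_on :: "'a set \<Rightarrow> ('a \<Rightarrow> 'a \<Rightarrow> real) \<Rightarrow> 'a \<Rightarrow> 'a \<Rightarrow> real" where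
  "pseudoinverse_on V A = (THE X. is_pseudoinverse_on V A X)"

definition laplacian :: "('a, 'b) pre_digraph \<Rightarrow> 'a \<Rightarrow> 'a \<Rightarrow> real" where
  "laplacian G v w =
    (if v = w then real (in_degree G v + out_degree G v)
     else - real (card {e \<in> arcs G. {tail G e, head G e} = {v, w}}))"

definition effective_resistance :: "('a, 'b) pre_digraph \<Rightarrow> 'a \<Rightarrow> 'a \<Rightarrow> real" where
  "effective_resistance G x y =
    (let d = (\<lambda>v. of_bool (v = x) - of_bool (v = y)) in
     \<Sum>u\<in>verts G. \<Sum>v\<in>verts G. d u * pseudoinverse_on (verts G) (laplacian G) u v * d v)"

end

theory Submission
  imports Defs
begin

text \<open>
  Write \<open>\<kappa>(Q)\<close> for the number of spanning forests in which every component contains exactly one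
  vertex of \<open>Q\<close>. Among the forests rooted at \<open>Q \<union> {x}\<close>, the number of those in which \<open>y\<close> lies in
  the component of \<open>x\<close> is, as a function of \<open>y\<close>, zero on \<open>Q\<close> and has Laplacian \<open>\<kappa>(Q) \<delta>\<^sub>x\<close> off \<open>Q\<close>: removing
  the first edge on the way from \<open>y\<close> to its root turns a forest rooted at \<open>Q\<close> into one rooted at
  \<open>Q \<union> {y}\<close> together with an edge at \<open>y\<close>. Hence, with \<open>g\<close> the Green function grounded at \<open>q\<close>,
  \<open>\<kappa>(q,x) = \<kappa>(q) g(x,x)\<close> and \<open>\<kappa>(q,x,y) = \<kappa>(q) (g(x,x) g(y,y) - g(x,y)\<^sup>2)\<close>.

  In a two-component forest the component avoiding \<open>q\<close> has one vertex more than it has edges, so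
  \<open>\<kappa>\<^sub>2(G)\<close> is the sum of \<open>\<kappa>(q,x)\<close> over the vertices minus the sum of \<open>\<kappa>(q,x,y)\<close> over the edges \<open>xy\<close>.
  The formula follows from \<open>r(x,y) = g(x,x) + g(y,y) - 2 g(x,y)\<close> and
  \<open>\<Sum>\<^sub>e (g(x,x) - g(y,y))\<^sup>2 = 2 \<Sum>\<^sub>x g(x,x) - \<Sum>\<^sub>e r(x,y) (g(x,x) + g(y,y))\<close>, which is the identity
  \<open>(a - b)\<^sup>2 = a (a - b) + b (b - a)\<close> summed over the edges, with the Laplacian of \<open>g(x,\<cdot>)\<close> at \<open>x\<close> equal to \<open>1\<close>.
\<close>

section \<open>Rooted spanning forests\<close>

context pre_digraph
begin

text \<open>Indexed by edge sets and taken over the whole vertex type, so that adding or deleting an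
  edge changes only the argument and no membership side conditions arise.\<close>

definition conn :: "'b set \<Rightarrow> 'a \<Rightarrow> 'a \<Rightarrow> bool" where
  "conn S = equivclp (\<lambda>u v. \<exists>e\<in>S. u = tail G e \<and> v = head G e)"

definition conn_class :: "'b set \<Rightarrow> 'a \<Rightarrow> 'a set" where
  "conn_class S u = {v. conn S u v}"

text \<open>Acyclicity in the form that every edge is a bridge;
  \<open>undirected_forest_iff_arcs\<close> matches it with the absence of dart cycles.\<close>

definition forest_set :: "'b set \<Rightarrow> bool" where
  "forest_set S \<longleftrightarrow> (\<forall>e\<in>S. \<not> conn (S - {e}) (tail G e) (head G e))"

definition rooted_forests :: "'a set \<Rightarrow> 'b set set" where
  "rooted_forests Q = {S. S \<subseteq> arcs G \<and> forest_set S \<and>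
     (\<forall>r\<in>Q. \<forall>r'\<in>Q. conn S r r' \<longrightarrow> r = r') \<and> (\<forall>v\<in>verts G. \<exists>r\<in>Q. conn S v r)}"

definition incident :: "'a \<Rightarrow> 'b set" where
  "incident v = {e \<in> arcs G. tail G e = v \<or> head G e = v}"

definition opp :: "'b \<Rightarrow> 'a \<Rightarrow> 'a" where
  "opp e v = (if tail G e = v then head G e else tail G e)"

lemma conn_refl [simp, intro]: "conn S u u"
  by (simp add: conn_def)

lemma conn_sym: "conn S u v \<Longrightarrow> conn S v u"
  unfolding conn_def by (rule equivclp_sym)

lemma conn_commute: "conn S u v \<longleftrightarrow> conn S v u"
  by (blast intro: conn_sym)

lemma conn_trans: "conn S u v \<Longrightarrow> conn S v w \<Longrightarrow> conn S u w"
  unfolding conn_def by (rule equivclp_trans)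

text \<open>Turns goals about connectivity into pure equational reasoning.\<close>

lemma conn_iff_class: "conn S u v \<longleftrightarrow> conn_class S u = conn_class S v"
  unfolding conn_class_def by (blast intro: conn_trans conn_sym)

lemma conn_arc: "e \<in> S \<Longrightarrow> conn S (tail G e) (head G e)"
  unfolding conn_def by (rule r_into_equivclp) blast

lemma conn_induct [consumes 1, case_names base step]:
  assumes "conn S u v" "P u"
    and "\<And>a b e. e \<in> S \<Longrightarrow> conn S u a \<Longrightarrow> P a \<Longrightarrow>
      (a = tail G e \<and> b = head G e) \<or> (a = head G e \<and> b = tail G e) \<Longrightarrow> P b"
  shows "P v"
  using assms(1) unfolding conn_def
proof (induction rule: equivclp_induct)
  case base
  then show ?case by (rule assms(2))
next
  case (step y z)
  then show ?case using assms(3)[of _ y z] unfolding conn_def by blast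
qed

lemma conn_mono:
  assumes "conn S u v" "S \<subseteq> T" shows "conn T u v"
  using assms(1)
proof (induction rule: conn_induct)
  case (step a b e)
  then show ?case using conn_arc[of e T] assms(2) by (blast intro: conn_trans conn_sym)
qed simp

text \<open>A walk can be shortened so that it crosses \<open>e\<close> at most once, in one of the
  two directions.\<close>

lemma conn_insert:
  "conn (insert e S) u v \<longleftrightarrow> conn S u v \<or> (conn S u (tail G e) \<and> conn S (head G e) v)
    \<or> (conn S u (head G e) \<and> conn S (tail G e) v)" (is "?L \<longleftrightarrow> ?R v")
proof
  assume ?L
  then show "?R v"
  proof (induction rule: conn_induct)
    case (step a b f)
    show ?case
    proof (cases "f = e")
      case True
      then show ?thesis using step by (metis conn_refl)
    next
      case False
      then have "conn S a b" using step(1,3) conn_arc[of f S] by (auto intro: conn_sym)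
      then show ?thesis using step(4) by (blast intro: conn_trans)
    qed
  qed simp
next
  have "conn (insert e S) (tail G e) (head G e)" by (simp add: conn_arc)
  moreover have "conn (insert e S) a b" if "conn S a b" for a b
    using that by (rule conn_mono) blast
  moreover assume "?R v"
  ultimately show ?L unfolding conn_iff_class by metis
qed

lemma conn_insert_incident:
  assumes "e \<in> incident y"
  shows "conn (insert e S) u v \<longleftrightarrow> conn S u v \<or> (conn S u y \<and> conn S (opp e y) v)
    \<or> (conn S u (opp e y) \<and> conn S y v)"
  using assms unfolding conn_insert incident_def opp_def by auto

lemma forest_set_mono: "forest_set T \<Longrightarrow> S \<subseteq> T \<Longrightarrow> forest_set S"
  unfolding forest_set_def by (meson conn_mono Diff_mono order_refl subsetD)

text \<open>The case to watch: if \<open>f\<close> stops being a bridge once \<open>e\<close> is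
  added, then \<open>S - {f}\<close> joins the ends of \<open>f\<close> to those of
  \<open>e\<close>, and with \<open>f\<close> itself the ends of \<open>e\<close> become connected
  in \<open>S\<close>.\<close>

lemma forest_set_insert:
  assumes "e \<notin> S"
  shows "forest_set (insert e S) \<longleftrightarrow> forest_set S \<and> \<not> conn S (tail G e) (head G e)"
proof
  assume "forest_set (insert e S)"
  moreover have "insert e S - {e} = S" using assms by blast
  ultimately show "forest_set S \<and> \<not> conn S (tail G e) (head G e)"
    using forest_set_mono[of "insert e S" S] unfolding forest_set_def by force
next
  assume R: "forest_set S \<and> \<not> conn S (tail G e) (head G e)"
  show "forest_set (insert e S)"
    unfolding forest_set_def
  proof
    fix f assume f: "f \<in> insert e S"
    show "\<not> conn (insert e S - {f}) (tail G f) (head G f)"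
    proof (cases "f = e")
      case True
      then show ?thesis using R assms by simp
    next
      case False
      then have eq: "insert e S - {f} = insert e (S - {f})" and "f \<in> S" using f by auto
      have up: "conn S a b" if "conn (S - {f}) a b" for a b
        using that by (rule conn_mono) blast
      have "conn S (tail G f) (head G f)" using \<open>f \<in> S\<close> by (rule conn_arc)
      moreover have "\<not> conn (S - {f}) (tail G f) (head G f)"
        using R \<open>f \<in> S\<close> by (auto simp: forest_set_def)
      ultimately show ?thesis
        unfolding eq conn_insert using R up unfolding conn_iff_class by metis
    qed
  qed
qed

lemma forest_set_insert_incident:
  assumes "e \<in> incident y" "e \<notin> S"
  shows "forest_set (insert e S) \<longleftrightarrow> forest_set S \<and> \<not> conn S (opp e y) y"
  using assms(1) conn_commute[of S "tail G e" "head G e"]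
  unfolding forest_set_insert[OF assms(2)] incident_def opp_def by auto

lemma forest_set_incidentD:
  assumes "forest_set S" "e \<in> S" "e \<in> incident y"
  shows "\<not> conn (S - {e}) (opp e y) y"
  using assms forest_set_insert_incident[of e y "S - {e}"] by (simp add: insert_absorb)

lemma conn_opp: "e \<in> S \<Longrightarrow> e \<in> incident y \<Longrightarrow> conn S y (opp e y)"
  using conn_arc[of e S] by (auto simp: incident_def opp_def intro: conn_sym)

text \<open>A walk from \<open>y\<close> to \<open>z\<close> is cut at its last visit to
  \<open>y\<close>; what follows the next edge uses no edge at \<open>y\<close>.\<close>

lemma first_edge_exists:
  assumes "conn S y z" "y \<noteq> z" "S \<subseteq> arcs G"
  obtains e where "e \<in> S" "e \<in> incident y" "conn (S - {e}) (opp e y) z"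
proof -
  define R where "R = S - incident y"
  have iso: "u = y" if "conn R y u" for u
    using that
  proof (induction rule: conn_induct)
    case (step a b e)
    then show ?case using assms(3) by (auto simp: R_def incident_def)
  qed simp
  have "z = y \<or> (\<exists>e\<in>S \<inter> incident y. conn R (opp e y) z)"
    using assms(1)
  proof (induction rule: conn_induct)
    case base
    then show ?case by simp
  next
    case (step a b f)
    show ?case
    proof (cases "f \<in> incident y")
      case True
      then have "b = y \<or> b = opp f y" using step(3) by (auto simp: incident_def opp_def)
      then show ?thesis using True step(1) by auto
    next
      case False
      then have "f \<in> R" using step(1) by (simp add: R_def)
      then have "conn R a b" using step(3) conn_arc[of f R] by (auto intro: conn_sym)
      moreover have "a \<noteq> y" using step(1,3) False assms(3) by (auto simp: incident_def)
      ultimately show ?thesis using step(4) by (blast intro: conn_trans)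
    qed
  qed
  then obtain e where "e \<in> S" "e \<in> incident y" "conn R (opp e y) z" using assms(2) by blast
  moreover have "R \<subseteq> S - {e}" using \<open>e \<in> incident y\<close> by (auto simp: R_def)
  ultimately show thesis using that conn_mono by blast
qed

text \<open>With both edges deleted, \<open>z\<close> is still reached from both far ends; so with
  \<open>e'\<close> kept, \<open>y\<close> would reach \<open>z\<close> without
  \<open>e\<close>.\<close>

lemma first_edge_unique:
  assumes e: "e \<in> S" "e \<in> incident y" "conn (S - {e}) (opp e y) z" "\<not> conn (S - {e}) y z"
    and e': "e' \<in> S" "e' \<in> incident y" "conn (S - {e'}) (opp e' y) z" "\<not> conn (S - {e'}) y z"
  shows "e = e'"
proof (rule ccontr)
  assume "e \<noteq> e'"
  define R where "R = S - {e} - {e'}"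
  have 1: "S - {e} = insert e' R" and 2: "S - {e'} = insert e R"
    using e e' \<open>e \<noteq> e'\<close> by (auto simp: R_def)
  have "conn R (opp e y) z" "conn R (opp e' y) z"
    using e(3,4) e'(3,4) unfolding 1 2 conn_insert_incident[OF e(2)] conn_insert_incident[OF e'(2)]
    unfolding conn_iff_class by metis+
  then show False
    using e(4) unfolding 1 conn_insert_incident[OF e'(2)] by blast
qed

lemma rooted_forests_roots_distinct:
  "S \<in> rooted_forests Q \<Longrightarrow> r \<in> Q \<Longrightarrow> r' \<in> Q \<Longrightarrow> conn S r r' \<Longrightarrow> r = r'"
  by (auto simp: rooted_forests_def)

end

section \<open>Exchanging a root for an edge\<close>

locale loopfree_multigraph = fin_digraph G + loopfree_digraph G
  for G :: "('a, 'b) pre_digraph" (structure)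
begin

lemma finite_rooted_forests [simp, intro]: "finite (rooted_forests Q)"
  by (rule finite_subset[of _ "Pow (arcs G)"]) (auto simp: rooted_forests_def)

lemma finite_incident [simp, intro]: "finite (incident v)"
  by (simp add: incident_def)

lemma opp_in_verts: "e \<in> incident v \<Longrightarrow> opp e v \<in> verts G"
  by (auto simp: incident_def opp_def)

text \<open>The edge \<open>e\<close> leads from the tree of \<open>y\<close> into the tree of some
  \<open>r\<close> in \<open>Q\<close>; the merged tree keeps \<open>r\<close> as its only
  root.\<close>

lemma insert_rooted_forest:
  assumes "y \<in> verts G" "y \<notin> Q" "S \<in> rooted_forests (insert y Q)"
    and e: "e \<in> incident y" "\<not> conn S (opp e y) y"
  shows "e \<notin> S" "insert e S \<in> rooted_forests Q"
proof -
  note D = assms(3)[unfolded rooted_forests_def, simplified]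
  show "e \<notin> S" using e conn_opp[of e S y] by (blast intro: conn_sym)
  have arcs: "insert e S \<subseteq> arcs G" using D e by (auto simp: incident_def)
  have forest: "forest_set (insert e S)"
    using D e \<open>e \<notin> S\<close> by (simp add: forest_set_insert_incident)
  obtain r where r: "r \<in> Q" "conn S (opp e y) r" using D opp_in_verts[OF e(1)] e(2) by blast
  have sep: "a = b" if "a \<in> Q" "b \<in> Q" "conn (insert e S) a b" for a b
    using that D assms(2) unfolding conn_insert_incident[OF e(1)] by (metis conn_sym)
  have cov: "\<exists>r\<in>Q. conn (insert e S) v r" if "v \<in> verts G" for v
    using that D r unfolding conn_insert_incident[OF e(1)] by blast
  show "insert e S \<in> rooted_forests Q"
    unfolding rooted_forests_def using arcs forest sep cov by blast
qed

text \<open>The inverse deletes the first edge on the way from \<open>y\<close> to its root.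
  Injectivity holds because \<open>e\<close> and \<open>e'\<close> are both this first edge, towards
  the same root in the same forest.\<close>

lemma rooted_forest_decomposition:
  assumes "y \<in> verts G" "y \<notin> Q"
  shows "bij_betw (\<lambda>(S, e). insert e S)
    (SIGMA S:rooted_forests (insert y Q). {e \<in> incident y. \<not> conn S (opp e y) y})
    (rooted_forests Q)"
  unfolding bij_betw_def
proof
  show "inj_on (\<lambda>(S, e). insert e S)
    (SIGMA S:rooted_forests (insert y Q). {e \<in> incident y. \<not> conn S (opp e y) y})"
  proof (rule inj_onI, clarify)
    fix S e S' e'
    assume S: "S \<in> rooted_forests (insert y Q)" and e: "e \<in> incident y" "\<not> conn S (opp e y) y"
      and S': "S' \<in> rooted_forests (insert y Q)" and e': "e' \<in> incident y" "\<not> conn S' (opp e' y) y"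
      and eq: "insert e S = insert e' S'"
    note i = insert_rooted_forest[OF assms S e] and i' = insert_rooted_forest[OF assms S' e']
    have SU: "insert e S - {e} = S" "insert e S - {e'} = S'" using i i' eq by auto
    obtain r where r: "r \<in> Q" "conn S (opp e y) r"
      using S opp_in_verts[OF e(1)] e(2) unfolding rooted_forests_def by blast
    obtain r' where r': "r' \<in> Q" "conn S' (opp e' y) r'"
      using S' opp_in_verts[OF e'(1)] e'(2) unfolding rooted_forests_def by blast
    have "conn (insert e S) y r" using r by (simp add: conn_insert_incident[OF e(1)])
    moreover have "conn (insert e S) y r'"
      unfolding eq using r' by (simp add: conn_insert_incident[OF e'(1)])
    ultimately have "conn (insert e S) r r'" by (blast intro: conn_sym conn_trans)
    then have "r = r'" using i(2) r r' rooted_forests_roots_distinct by blast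
    have n: "\<not> conn S y r" "\<not> conn S' y r"
      using S S' r r' \<open>r = r'\<close> assms(2) rooted_forests_roots_distinct by (metis insert_iff)+
    have "e = e'"
      by (rule first_edge_unique[of e "insert e S" y r e'], unfold SU)
        (use e e' r r' n \<open>r = r'\<close> eq in auto)
    then show "S = S' \<and> e = e'" using SU by metis
  qed
next
  show "(\<lambda>(S, e). insert e S) `
    (SIGMA S:rooted_forests (insert y Q). {e \<in> incident y. \<not> conn S (opp e y) y}) = rooted_forests Q"
  proof safe
    fix S e assume "S \<in> rooted_forests (insert y Q)" "e \<in> incident y" "\<not> conn S (opp e y) y"
    then show "insert e S \<in> rooted_forests Q" using insert_rooted_forest assms by blast
  next
    fix S assume S: "S \<in> rooted_forests Q"
    note D = S[unfolded rooted_forests_def, simplified]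
    obtain z where z: "z \<in> Q" "conn S y z" using D assms(1) by blast
    then obtain e where e: "e \<in> S" "e \<in> incident y" "conn (S - {e}) (opp e y) z"
      using first_edge_exists[of S y z] assms(2) D by blast
    define T where "T = S - {e}"
    have ST: "S = insert e T" using e by (auto simp: T_def)
    have up: "conn S a b" if "conn T a b" for a b using that by (rule conn_mono) (auto simp: T_def)
    have ny: "\<not> conn T (opp e y) y" using forest_set_incidentD e D by (simp add: T_def)
    \<comment> \<open>A root still joined to \<open>y\<close> would have to be \<open>z\<close>, and
      then the two ends of the deleted edge would be connected without it.\<close>
    have yr: False if "r \<in> Q" "conn T y r" for r
    proof -
      have "conn S r z" using up[OF that(2)] z by (blast intro: conn_sym conn_trans)
      then have "r = z" using D that z by blast
      then show False using that e(3) ny by (auto simp: T_def intro: conn_trans conn_sym)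
    qed
    have "a = b" if "a \<in> insert y Q" "b \<in> insert y Q" "conn T a b" for a b
      using that yr D up by (metis conn_sym insert_iff)
    moreover have "\<exists>r\<in>insert y Q. conn T v r" if "v \<in> verts G" for v
    proof -
      have "\<exists>r\<in>Q. conn S v r" using D that by blast
      then obtain r where "r \<in> Q" "conn (insert e T) v r" unfolding ST by blast
      then consider "conn T v r" | "conn T v y" | "conn T v (opp e y)"
        unfolding conn_insert_incident[OF e(2)] by blast
      then show ?thesis
        using \<open>r \<in> Q\<close> z(1) conn_trans[OF _ e(3)[folded T_def], of v] by cases blast+
    qed
    moreover have "forest_set T" "T \<subseteq> arcs G" using D forest_set_mono[of S T] by (auto simp: T_def)
    ultimately have "T \<in> rooted_forests (insert y Q)" unfolding rooted_forests_def by blast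
    then show "S \<in> (\<lambda>(S, e). insert e S) `
      (SIGMA S:rooted_forests (insert y Q). {e \<in> incident y. \<not> conn S (opp e y) y})"
      using ny e ST by (intro image_eqI[of _ _ "(T, e)"]) auto
  qed
qed

text \<open>Weighted form of the bijection. The inner sum runs over all edges at \<open>y\<close>,
  with an indicator, so that it can be exchanged with the edge sum of a Laplacian.\<close>

lemma sum_rooted_forests:
  fixes \<phi> :: "'b set \<Rightarrow> real"
  assumes "y \<in> verts G" "y \<notin> Q"
  shows "(\<Sum>S\<in>rooted_forests Q. \<phi> S) = (\<Sum>S\<in>rooted_forests (insert y Q). \<Sum>e\<in>incident y.
    of_bool (\<not> conn S (opp e y) y) * \<phi> (insert e S))"
proof -
  have "(\<Sum>S\<in>rooted_forests Q. \<phi> S) =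
    (\<Sum>(S, e)\<in>(SIGMA S:rooted_forests (insert y Q). {e \<in> incident y. \<not> conn S (opp e y) y}).
      \<phi> (insert e S))"
    using sum.reindex_bij_betw[OF rooted_forest_decomposition[OF assms], of \<phi>]
    by (simp add: case_prod_unfold)
  also have "\<dots> = (\<Sum>S\<in>rooted_forests (insert y Q).
    \<Sum>e\<in>{e \<in> incident y. \<not> conn S (opp e y) y}. \<phi> (insert e S))"
    by (subst sum.Sigma) auto
  also have "\<dots> = (\<Sum>S\<in>rooted_forests (insert y Q). \<Sum>e\<in>incident y.
    of_bool (\<not> conn S (opp e y) y) * \<phi> (insert e S))"
    by (rule sum.cong[OF refl], rule sum.mono_neutral_cong_left) auto
  finally show ?thesis .
qed

section \<open>Rooted counts and their Laplacians\<close>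

definition rooted_count :: "'a set \<Rightarrow> real" where
  "rooted_count Q = real (card (rooted_forests Q))"

text \<open>For a vertex \<open>x\<close> outside \<open>Q\<close>, this is the numerator of the
  Green function grounded at \<open>Q\<close>; the denominator is
  \<open>rooted_count Q\<close>.\<close>

definition rooted_count_conn :: "'a set \<Rightarrow> 'a \<Rightarrow> 'a \<Rightarrow> real" where
  "rooted_count_conn Q x y = (\<Sum>S\<in>rooted_forests (insert x Q). of_bool (conn S y x))"

text \<open>Summing over edges rather than neighbours counts parallel edges with
  multiplicity.\<close>

definition lap :: "('a \<Rightarrow> real) \<Rightarrow> 'a \<Rightarrow> real" where
  "lap f v = (\<Sum>e\<in>incident v. f v - f (opp e v))"

lemma rooted_count_conn_self: "rooted_count_conn Q x x = rooted_count (insert x Q)"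
  by (simp add: rooted_count_conn_def rooted_count_def)

lemma rooted_count_conn_root:
  assumes "x \<notin> Q" "y \<in> Q" shows "rooted_count_conn Q x y = 0"
  unfolding rooted_count_conn_def
  by (rule sum.neutral) (use assms rooted_forests_roots_distinct in fastforce)

text \<open>The Laplacian at \<open>x\<close> counts the pairs of a forest rooted at
  \<open>insert x Q\<close> and an edge at \<open>x\<close> that leaves the tree of
  \<open>x\<close>; by the decomposition these are the forests rooted at \<open>Q\<close>.\<close>

lemma lap_rooted_count_conn_self:
  assumes "x \<in> verts G" "x \<notin> Q"
  shows "lap (rooted_count_conn Q x) x = rooted_count Q"
proof -
  have "rooted_count Q = (\<Sum>S\<in>rooted_forests Q. 1)" by (simp add: rooted_count_def)
  also have "\<dots> = (\<Sum>S\<in>rooted_forests (insert x Q). \<Sum>e\<in>incident x.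
      of_bool (conn S x x) - of_bool (conn S (opp e x) x))"
    unfolding sum_rooted_forests[OF assms] by (intro sum.cong refl) simp
  also have "\<dots> = lap (rooted_count_conn Q x) x"
    unfolding lap_def rooted_count_conn_def sum_subtractf[symmetric]
    by (rule sum.swap)
  finally show ?thesis by simp
qed

lemma lap_rooted_count_conn_other:
  assumes "x \<in> verts G" "y \<in> verts G" "y \<notin> Q" "y \<noteq> x"
  shows "lap (rooted_count_conn Q x) y = 0"
proof -
  let ?R = "rooted_forests (insert y (insert x Q))"
  have y: "y \<notin> insert x Q" using assms by simp
  let ?a = "\<lambda>S e. of_bool (conn S (opp e y) x) :: real"
  let ?c = "\<lambda>S e. of_bool (conn S (opp e y) y) :: real"
  have xy: "\<not> conn S x y" "\<not> conn S y x" if "S \<in> ?R" for S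
    using that assms(4) rooted_forests_roots_distinct[OF that] by blast+
  \<comment> \<open>A forest rooted at \<open>Q \<union> {x}\<close> is a forest \<open>S\<close> rooted at \<open>Q \<union> {x, y}\<close> plus an edge \<open>e\<close> at \<open>y\<close> not
    returning to \<open>y\<close>; the contribution of a second edge \<open>f\<close> at \<open>y\<close> is antisymmetric in \<open>e\<close> and \<open>f\<close>.\<close>
  have trm: "of_bool (\<not> conn S (opp e y) y) * (of_bool (conn (insert e S) y x)
      - of_bool (conn (insert e S) (opp f y) x)) = ?a S e - ?a S f + ?c S e * ?a S f - ?c S f * ?a S e"
    if S: "S \<in> ?R" and e: "e \<in> incident y" and f: "f \<in> incident y" for S e f
  proof -
    \<comment> \<open>No vertex lies in the trees of both \<open>x\<close> and \<open>y\<close>, so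
      \<open>?c\<close> and \<open>?a\<close> at the same edge multiply to zero; this kills the
      remaining terms of the expanded product.\<close>
    have ex: "\<not> (conn S (opp e y) y \<and> conn S (opp e y) x)" for e
      using xy[OF S] unfolding conn_iff_class by metis
    have "conn (insert e S) y x \<longleftrightarrow> conn S (opp e y) x"
      using xy[OF S] by (auto simp: conn_insert_incident[OF e])
    moreover have "conn (insert e S) (opp f y) x \<longleftrightarrow>
        conn S (opp f y) x \<or> conn S (opp f y) y \<and> conn S (opp e y) x"
      using xy[OF S] by (auto simp: conn_insert_incident[OF e])
    ultimately show ?thesis using ex[of e] ex[of f] by auto
  qed
  have "lap (rooted_count_conn Q x) y =
    (\<Sum>f\<in>incident y. \<Sum>S\<in>rooted_forests (insert x Q). of_bool (conn S y x) - of_bool (conn S (opp f y) x))"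
    by (simp add: lap_def rooted_count_conn_def sum_subtractf)
  also have "\<dots> = (\<Sum>f\<in>incident y. \<Sum>S\<in>?R. \<Sum>e\<in>incident y.
      ?a S e - ?a S f + ?c S e * ?a S f - ?c S f * ?a S e)"
    unfolding sum_rooted_forests[OF assms(2) y] by (intro sum.cong refl trm)
  also have "\<dots> = (\<Sum>S\<in>?R. \<Sum>f\<in>incident y. \<Sum>e\<in>incident y.
      ?a S e - ?a S f + ?c S e * ?a S f - ?c S f * ?a S e)"
    by (rule sum.swap)
  also have "\<dots> = 0"
  proof (rule sum.neutral, rule ballI)
    fix S
    have "(\<Sum>f\<in>incident y. \<Sum>e\<in>incident y. ?c S e * ?a S f) =
      (\<Sum>f\<in>incident y. \<Sum>e\<in>incident y. ?c S f * ?a S e)"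
      by (rule sum.swap)
    moreover have "(\<Sum>f\<in>incident y. \<Sum>e\<in>incident y. ?a S f) =
      (\<Sum>f\<in>incident y. \<Sum>e\<in>incident y. ?a S e)"
      by (rule sum.swap)
    ultimately show "(\<Sum>f\<in>incident y. \<Sum>e\<in>incident y.
      ?a S e - ?a S f + ?c S e * ?a S f - ?c S f * ?a S e) = 0"
      unfolding sum_subtractf sum.distrib by linarith
  qed
  finally show ?thesis .
qed

end

section \<open>Counting forests with two components\<close>

lemma card_sum_swap:
  assumes "finite A" "finite B"
  shows "(\<Sum>a\<in>A. card {b \<in> B. P a b}) = (\<Sum>b\<in>B. card {a \<in> A. P a b})"
  using sum_multicount_gen[of A B "\<lambda>a b. P a b" "\<lambda>b. card {a \<in> A. P a b}"] assms by simp

context loopfree_multigraph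
begin

text \<open>Exactly two components, seen from the vertex \<open>q\<close>: \<open>x\<close> is any
  representative of the component that avoids \<open>q\<close>.\<close>

definition two_forests :: "'a \<Rightarrow> 'b set set" where
  "two_forests q = {S. S \<subseteq> arcs G \<and> forest_set S \<and>
     (\<exists>x\<in>verts G. \<not> conn S q x \<and> (\<forall>v\<in>verts G. conn S v q \<or> conn S v x))}"

lemma finite_two_forests [simp, intro]: "finite (two_forests q)"
  by (rule finite_subset[of _ "Pow (arcs G)"]) (auto simp: two_forests_def)

lemma rooted_forests_pair:
  assumes "q \<in> verts G" "x \<in> verts G" "x \<noteq> q"
  shows "rooted_forests {q, x} = {S \<in> two_forests q. \<not> conn S q x}"
proof safe
  fix S assume S: "S \<in> rooted_forests {q, x}"
  show n: False if "conn S q x"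
    using rooted_forests_roots_distinct[OF S, of q x] that assms by auto
  show "S \<in> two_forests q"
    using S n assms unfolding rooted_forests_def two_forests_def by blast
next
  fix S assume S: "S \<in> two_forests q" "\<not> conn S q x"
  then obtain z where z: "z \<in> verts G" "\<not> conn S q z" "\<forall>v\<in>verts G. conn S v q \<or> conn S v z"
    and D: "S \<subseteq> arcs G" "forest_set S"
    unfolding two_forests_def by blast
  have xz: "conn S z x" using z S(2) assms(2) conn_sym by blast
  have "\<exists>r\<in>{q, x}. conn S v r" if "v \<in> verts G" for v
    using z(3) that xz by (blast intro: conn_trans)
  moreover have "\<forall>r\<in>{q, x}. \<forall>r'\<in>{q, x}. conn S r r' \<longrightarrow> r = r'"
    using S(2) conn_sym by blast
  ultimately show "S \<in> rooted_forests {q, x}" unfolding rooted_forests_def using D by blast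
qed

text \<open>Inserting \<open>e\<close> merges the trees of its ends into one tree avoiding
  \<open>q\<close>, and deleting it splits that tree again. The condition on \<open>tail G e\<close>
  places \<open>e\<close> in the component avoiding \<open>q\<close>.\<close>

lemma card_rooted_forests_triple:
  assumes "q \<in> verts G" "e \<in> arcs G" "tail G e \<noteq> q" "head G e \<noteq> q"
  shows "card (rooted_forests {q, tail G e, head G e}) =
    card {S \<in> two_forests q. e \<in> S \<and> \<not> conn S q (tail G e)}"
proof (rule bij_betw_same_card[of "insert e"], rule bij_betw_byWitness[where f' = "\<lambda>S. S - {e}"])
  let ?x = "tail G e" and ?y = "head G e"
  have xy: "?x \<noteq> ?y" "?x \<in> verts G" "?y \<in> verts G" using assms(2) no_loops by auto
  have e: "e \<notin> S \<and> insert e S \<in> two_forests q \<and> \<not> conn (insert e S) q ?x"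
    if S: "S \<in> rooted_forests {q, ?x, ?y}" for S
  proof -
    have n: "\<not> conn S ?x ?y" "\<not> conn S q ?x" "\<not> conn S q ?y"
      using rooted_forests_roots_distinct[OF S] xy assms by blast+
    then have "e \<notin> S" using conn_arc by blast
    moreover have "forest_set (insert e S)" "insert e S \<subseteq> arcs G"
      using S n \<open>e \<notin> S\<close> assms by (auto simp: rooted_forests_def forest_set_insert)
    moreover have nq: "\<not> conn (insert e S) q ?x" using n by (auto simp: conn_insert)
    moreover have "conn (insert e S) v q \<or> conn (insert e S) v ?x" if "v \<in> verts G" for v
      using S that unfolding rooted_forests_def conn_insert by auto
    ultimately show ?thesis unfolding two_forests_def using xy by blast
  qed
  have d: "S - {e} \<in> rooted_forests {q, ?x, ?y}"
    if S: "S \<in> two_forests q" "e \<in> S" "\<not> conn S q ?x" for S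
  proof -
    obtain T where T: "S = insert e T" "e \<notin> T" using S(2) by (meson Set.set_insert)
    obtain z where z: "\<not> conn S q z" "\<forall>v\<in>verts G. conn S v q \<or> conn S v z"
      and D: "S \<subseteq> arcs G" "forest_set S"
      using S(1) unfolding two_forests_def by blast
    have zx: "conn S z ?x" using z(2) S(3) xy conn_sym by blast
    have f: "forest_set T" "\<not> conn T ?x ?y" using D T by (auto simp: forest_set_insert)
    have q: "\<not> conn T q ?x" "\<not> conn T q ?y"
      using S(3) unfolding T(1) conn_insert by auto
    have "\<exists>r\<in>{q, ?x, ?y}. conn T v r" if "v \<in> verts G" for v
    proof -
      have "conn (insert e T) v q \<or> conn (insert e T) v ?x"
        using z(2) zx that conn_trans unfolding T(1) by blast
      then show ?thesis unfolding conn_insert by blast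
    qed
    moreover have "\<forall>r\<in>{q, ?x, ?y}. \<forall>r'\<in>{q, ?x, ?y}. conn T r r' \<longrightarrow> r = r'"
      using f q conn_sym by blast
    ultimately have "T \<in> rooted_forests {q, ?x, ?y}"
      unfolding rooted_forests_def using f D T by blast
    then show ?thesis using T by simp
  qed
  show "\<forall>S\<in>rooted_forests {q, ?x, ?y}. insert e S - {e} = S" using e by auto
  show "\<forall>S\<in>{S \<in> two_forests q. e \<in> S \<and> \<not> conn S q ?x}. insert e (S - {e}) = S" by auto
  show "insert e ` rooted_forests {q, ?x, ?y} \<subseteq> {S \<in> two_forests q. e \<in> S \<and> \<not> conn S q ?x}"
    using e by auto
  show "(\<lambda>S. S - {e}) ` {S \<in> two_forests q. e \<in> S \<and> \<not> conn S q ?x} \<subseteq> rooted_forests {q, ?x, ?y}"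
    using d by auto
qed

text \<open>Each vertex other than \<open>x\<close> is matched with the first edge on its way to
  \<open>x\<close>; \<open>lower\<close> sends that edge back to the vertex.\<close>

lemma card_component:
  assumes "x \<in> verts G" "S \<subseteq> arcs G" "forest_set S"
  shows "card {v \<in> verts G. conn S v x} = card {e \<in> S. conn S (tail G e) x} + 1"
proof -
  \<comment> \<open>the endpoint of \<open>e\<close> farther from \<open>x\<close>\<close>
  define lower where "lower e = (if conn (S - {e}) (tail G e) x then head G e else tail G e)" for e
  have low: "e \<in> incident (lower e) \<and> conn (S - {e}) (opp e (lower e)) x
      \<and> \<not> conn (S - {e}) (lower e) x"
    if e: "e \<in> S" "conn S (tail G e) x" for e
  proof -
    obtain T where T: "S = insert e T" "e \<notin> T" using e(1) by (meson Set.set_insert)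
    have n: "\<not> conn T (tail G e) (head G e)" using assms(3) T by (simp add: forest_set_insert)
    have eq: "S - {e} = T" using T by auto
    have "conn T (tail G e) x \<or> conn T (head G e) x" using e(2) unfolding T(1) conn_insert by auto
    moreover have "\<not> (conn T (tail G e) x \<and> conn T (head G e) x)"
      using n by (blast intro: conn_trans conn_sym)
    moreover have "e \<in> arcs G" "tail G e \<noteq> head G e" using assms(2) e no_loops by auto
    ultimately show ?thesis unfolding lower_def eq by (auto simp: incident_def opp_def)
  qed
  have uniq: "lower e = y" if "e \<in> S" "e \<in> incident y" "conn (S - {e}) (opp e y) x" for e y
  proof -
    have "\<not> conn (S - {e}) y x"
      using forest_set_incidentD[OF assms(3) that(1,2)] that(3) by (blast intro: conn_trans conn_sym)
    then show ?thesis using that by (auto simp: lower_def incident_def opp_def split: if_splits)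
  qed
  have "bij_betw lower {e \<in> S. conn S (tail G e) x} ({v \<in> verts G. conn S v x} - {x})"
    unfolding bij_betw_def
  proof
    show "inj_on lower {e \<in> S. conn S (tail G e) x}"
    proof (rule inj_onI, clarify)
      fix e f assume e: "e \<in> S" "conn S (tail G e) x" and f: "f \<in> S" "conn S (tail G f) x"
        and eq: "lower e = lower f"
      show "e = f"
        using first_edge_unique[of e S "lower e" x f] low[OF e] low[OF f] e f eq by auto
    qed
    show "lower ` {e \<in> S. conn S (tail G e) x} = {v \<in> verts G. conn S v x} - {x}"
    proof (intro equalityI subsetI)
      fix y assume "y \<in> lower ` {e \<in> S. conn S (tail G e) x}"
      then obtain e where e: "e \<in> S" "conn S (tail G e) x" and y: "y = lower e" by blast
      have "conn S y x"
        using e conn_arc[OF e(1)] by (auto simp: lower_def y intro: conn_trans conn_sym)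
      moreover have "y \<in> verts G" using assms(2) e by (auto simp: lower_def y)
      moreover have "y \<noteq> x" using low[OF e] y by auto
      ultimately show "y \<in> {v \<in> verts G. conn S v x} - {x}" by blast
    next
      fix y assume y: "y \<in> {v \<in> verts G. conn S v x} - {x}"
      then obtain e where e: "e \<in> S" "e \<in> incident y" "conn (S - {e}) (opp e y) x"
        using first_edge_exists[of S y x] assms(2) by blast
      have "conn S (tail G e) x"
        using e(2) y conn_arc[OF e(1)] by (auto simp: incident_def intro: conn_trans)
      then show "y \<in> lower ` {e \<in> S. conn S (tail G e) x}" using e uniq by blast
    qed
  qed
  then have "card {e \<in> S. conn S (tail G e) x} = card ({v \<in> verts G. conn S v x} - {x})"
    by (rule bij_betw_same_card)
  then show ?thesis using card_Suc_Diff1[of "{v \<in> verts G. conn S v x}" x] assms(1) by simp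
qed

lemma card_two_forests:
  assumes q: "q \<in> verts G"
  shows "real (card (two_forests q)) = (\<Sum>x\<in>verts G - {q}. rooted_count {q, x})
    - (\<Sum>e | e \<in> arcs G \<and> tail G e \<noteq> q \<and> head G e \<noteq> q. rooted_count {q, tail G e, head G e})"
proof -
  have c1: "card {v \<in> verts G. \<not> conn S q v} = card {e \<in> arcs G. e \<in> S \<and> \<not> conn S q (tail G e)} + 1"
    if S: "S \<in> two_forests q" for S
  proof -
    obtain z where z: "z \<in> verts G" "\<not> conn S q z" "\<forall>v\<in>verts G. conn S v q \<or> conn S v z"
      and D: "S \<subseteq> arcs G" "forest_set S"
      using S unfolding two_forests_def by blast
    have eq: "\<not> conn S q v \<longleftrightarrow> conn S v z" if "v \<in> verts G" for v
      using z that by (blast intro: conn_trans conn_sym)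
    have "{v \<in> verts G. \<not> conn S q v} = {v \<in> verts G. conn S v z}" using eq by blast
    moreover have "{e \<in> arcs G. e \<in> S \<and> \<not> conn S q (tail G e)} = {e \<in> S. conn S (tail G e) z}"
      using eq[OF tail_in_verts] D by blast
    ultimately show ?thesis using card_component[OF z(1) D] by simp
  qed
  have v: "(\<Sum>x\<in>verts G - {q}. card (rooted_forests {q, x})) =
    (\<Sum>S\<in>two_forests q. card {v \<in> verts G. \<not> conn S q v})"
  proof -
    have "(\<Sum>x\<in>verts G - {q}. card (rooted_forests {q, x})) =
      (\<Sum>x\<in>verts G - {q}. card {S \<in> two_forests q. \<not> conn S q x})"
      using rooted_forests_pair[OF q] by (intro sum.cong) auto
    also have "\<dots> = (\<Sum>x\<in>verts G. card {S \<in> two_forests q. \<not> conn S q x})"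
      using q by (simp add: sum.remove[of "verts G" q])
    also have "\<dots> = (\<Sum>S\<in>two_forests q. card {v \<in> verts G. \<not> conn S q v})"
      by (rule card_sum_swap) auto
    finally show ?thesis .
  qed
  have e: "(\<Sum>e | e \<in> arcs G \<and> tail G e \<noteq> q \<and> head G e \<noteq> q. card (rooted_forests {q, tail G e, head G e}))
    = (\<Sum>S\<in>two_forests q. card {e \<in> arcs G. e \<in> S \<and> \<not> conn S q (tail G e)})"
  proof -
    have "(\<Sum>e | e \<in> arcs G \<and> tail G e \<noteq> q \<and> head G e \<noteq> q. card (rooted_forests {q, tail G e, head G e}))
      = (\<Sum>e | e \<in> arcs G \<and> tail G e \<noteq> q \<and> head G e \<noteq> q.
          card {S \<in> two_forests q. e \<in> S \<and> \<not> conn S q (tail G e)})"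
      using card_rooted_forests_triple[OF q] by (intro sum.cong) auto
    \<comment> \<open>An edge of \<open>S\<close> at \<open>q\<close> has its tail in the component
      of \<open>q\<close>, so the added terms are zero.\<close>
    also have "\<dots> = (\<Sum>e\<in>arcs G. card {S \<in> two_forests q. e \<in> S \<and> \<not> conn S q (tail G e)})"
    proof (rule sum.mono_neutral_left)
      show "\<forall>e\<in>arcs G - {e. e \<in> arcs G \<and> tail G e \<noteq> q \<and> head G e \<noteq> q}.
        card {S \<in> two_forests q. e \<in> S \<and> \<not> conn S q (tail G e)} = 0"
      proof
        fix e assume "e \<in> arcs G - {e. e \<in> arcs G \<and> tail G e \<noteq> q \<and> head G e \<noteq> q}"
        then have "conn S q (tail G e)" if "e \<in> S" for S
          using conn_arc[OF that] by (auto intro: conn_sym)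
        then have "{S \<in> two_forests q. e \<in> S \<and> \<not> conn S q (tail G e)} = {}" by blast
        then show "card {S \<in> two_forests q. e \<in> S \<and> \<not> conn S q (tail G e)} = 0"
          by (metis card.empty)
      qed
    qed auto
    also have "\<dots> = (\<Sum>S\<in>two_forests q. card {e \<in> arcs G. e \<in> S \<and> \<not> conn S q (tail G e)})"
      by (rule card_sum_swap) auto
    finally show ?thesis .
  qed
  have "(\<Sum>S\<in>two_forests q. card {v \<in> verts G. \<not> conn S q v}) =
    (\<Sum>S\<in>two_forests q. card {e \<in> arcs G. e \<in> S \<and> \<not> conn S q (tail G e)}) + card (two_forests q)"
    by (simp only: sum.cong[OF refl c1] sum.distrib) simp
  then show ?thesis
    unfolding rooted_count_def of_nat_sum[symmetric] v e by simp
qed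

end

section \<open>The grounded Green function\<close>

context loopfree_multigraph
begin

text \<open>Factorisation through the signed incidence matrix, which lets sums over vertices be
  exchanged with sums over edges.\<close>

lemma lap_alt:
  "lap f v = (\<Sum>e\<in>arcs G. (of_bool (tail G e = v) - of_bool (head G e = v)) * (f (tail G e) - f (head G e)))"
  unfolding lap_def
proof (rule sum.mono_neutral_cong_left)
  show "f v - f (opp e v) =
      (of_bool (tail G e = v) - of_bool (head G e = v)) * (f (tail G e) - f (head G e))"
    if "e \<in> incident v" for e
    using that no_loops[of e] by (auto simp: incident_def opp_def)
qed (auto simp: incident_def)

text \<open>Summation by parts: pairing with the Laplacian is the Dirichlet form.\<close>

lemma sum_mult_lap:
  "(\<Sum>v\<in>verts G. f v * lap g v) =
    (\<Sum>e\<in>arcs G. (f (tail G e) - f (head G e)) * (g (tail G e) - g (head G e)))"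
proof -
  have "(\<Sum>v\<in>verts G. f v * lap g v) = (\<Sum>e\<in>arcs G. \<Sum>v\<in>verts G.
      (f v * of_bool (tail G e = v) - f v * of_bool (head G e = v)) * (g (tail G e) - g (head G e)))"
    unfolding lap_alt sum_distrib_left
    by (subst sum.swap) (simp add: algebra_simps)
  also have "\<dots> = (\<Sum>e\<in>arcs G. (f (tail G e) - f (head G e)) * (g (tail G e) - g (head G e)))"
    unfolding sum_distrib_right[symmetric] sum_subtractf
    by (intro sum.cong refl) (simp add: of_bool_def if_distrib cong: if_cong)
  finally show ?thesis .
qed

lemma sum_mult_lap_commute: "(\<Sum>v\<in>verts G. f v * lap g v) = (\<Sum>v\<in>verts G. g v * lap f v)"
  unfolding sum_mult_lap by (simp add: mult.commute)

lemma lap_linear: "lap (\<lambda>v. a * f v + b * g v) v = a * lap f v + b * lap g v"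
  by (simp add: lap_def sum_distrib_left sum.distrib[symmetric] algebra_simps)

end

section \<open>Uniqueness of potentials and the Green function grounded at \<open>q\<close>\<close>

locale connected_multigraph = loopfree_multigraph +
  fixes q :: 'a
  assumes root: "q \<in> verts G"
    and connected: "u \<in> verts G \<Longrightarrow> v \<in> verts G \<Longrightarrow> conn (arcs G) u v"
begin

text \<open>The Dirichlet energy of \<open>f\<close> vanishes, so \<open>f\<close> is constant along
  edges. The product hypothesis admits functions that at each vertex vanish or are harmonic, so any
  set of vertices containing \<open>r\<close> can be grounded.\<close>

lemma lap_zero_imp_zero:
  assumes "r \<in> verts G" "f r = 0" "\<And>v. v \<in> verts G \<Longrightarrow> f v * lap f v = 0" "v \<in> verts G"
  shows "f v = 0"
proof -
  have "(\<Sum>e\<in>arcs G. (f (tail G e) - f (head G e))\<^sup>2) = 0"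
    using sum_mult_lap[of f f] assms(3) by (simp add: power2_eq_square)
  then have "\<forall>e\<in>arcs G. (f (tail G e) - f (head G e))\<^sup>2 = 0"
    by (subst (asm) sum_nonneg_eq_0_iff) auto
  then have e: "f (tail G e) = f (head G e)" if "e \<in> arcs G" for e using that by simp
  from connected[OF assms(1,4)] have "f v = f r"
    by (induction rule: conn_induct) (auto dest: e)
  then show ?thesis using assms(2) by simp
qed

text \<open>A maximal forest joins the ends of every arc, since an arc with separated ends could be
  added to it.\<close>

lemma spanning_tree_exists: "rooted_count {q} > 0"
proof -
  define \<F> where "\<F> = {S. S \<subseteq> arcs G \<and> forest_set S}"
  have "finite \<F>" by (rule finite_subset[of _ "Pow (arcs G)"]) (auto simp: \<F>_def)
  moreover have "{} \<in> \<F>" by (simp add: \<F>_def forest_set_def)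
  ultimately obtain S where S: "S \<in> \<F>" and max: "\<And>T. T \<in> \<F> \<Longrightarrow> S \<subseteq> T \<Longrightarrow> S = T"
    using finite_has_maximal[of \<F>] by blast
  have e: "conn S (tail G e) (head G e)" if "e \<in> arcs G" for e
  proof (rule ccontr)
    assume n: "\<not> conn S (tail G e) (head G e)"
    then have "e \<notin> S" using conn_arc by blast
    then have "insert e S \<in> \<F>" using S n that by (simp add: \<F>_def forest_set_insert)
    then show False using max[of "insert e S"] \<open>e \<notin> S\<close> by blast
  qed
  have "conn S u v" if "conn (arcs G) u v" for u v
    using that
  proof (induction rule: conn_induct)
    case (step a b f)
    then show ?case using e[of f] by (blast intro: conn_trans conn_sym)
  qed simp
  then have "S \<in> rooted_forests {q}"
    using S connected root by (auto simp: rooted_forests_def \<F>_def)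
  then show ?thesis by (auto simp: rooted_count_def card_gt_0_iff)
qed

text \<open>The case \<open>x = q\<close> is separate because the quotient would be 1 at every
  vertex there: \<open>insert q {q}\<close> has no new root.\<close>

definition green :: "'a \<Rightarrow> 'a \<Rightarrow> real" where
  "green x v = (if x = q then 0 else rooted_count_conn {q} x v / rooted_count {q})"

lemma green_root_left [simp]: "green q v = 0"
  by (simp add: green_def)

lemma green_root_right [simp]: "green x q = 0"
  by (simp add: green_def rooted_count_conn_root)

lemma rooted_count_pair:
  "x \<noteq> q \<Longrightarrow> rooted_count {q, x} = rooted_count {q} * green x x"
  using spanning_tree_exists by (simp add: green_def rooted_count_conn_self insert_commute)

lemma lap_green:
  assumes "x \<in> verts G" "v \<in> verts G"
  shows "lap (green x) v = of_bool (v = x) - of_bool (v = q)"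
proof -
  have off: "lap (green x) v = of_bool (v = x)" if "v \<in> verts G" "v \<noteq> q" for v
  proof (cases "x = q")
    case True
    then show ?thesis using that by (simp add: lap_def)
  next
    case False
    have "lap (green x) v = lap (rooted_count_conn {q} x) v / rooted_count {q}"
      using False by (simp add: lap_def green_def sum_divide_distrib diff_divide_distrib)
    then show ?thesis
      using lap_rooted_count_conn_self[of x "{q}"] lap_rooted_count_conn_other[of x v "{q}"]
        spanning_tree_exists assms(1) that False
      by (cases "v = x") auto
  qed
  \<comment> \<open>The counting lemmas say nothing about the Laplacian at \<open>q\<close>; its
    value is forced since any Laplacian sums to zero.\<close>
  have "(\<Sum>v\<in>verts G. lap (green x) v) = 0"
    using sum_mult_lap[of "\<lambda>_. 1" "green x"] by simp
  then have "lap (green x) q = - (\<Sum>v\<in>verts G - {q}. lap (green x) v)"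
    using root by (simp add: sum.remove[of "verts G" q])
  also have "\<dots> = - (\<Sum>v\<in>verts G - {q}. of_bool (v = x))" using off by simp
  also have "\<dots> = of_bool (x = q) - 1" using assms(1) by (simp add: of_bool_def)
  finally show ?thesis using off[of v] assms(2) by (cases "v = q") auto
qed

text \<open>Reproducing property of the Green function; a function vanishing at \<open>q\<close>
  does not see the \<open>- 1\<close> there.\<close>

lemma sum_mult_lap_green:
  assumes "x \<in> verts G" "f q = 0"
  shows "(\<Sum>v\<in>verts G. f v * lap (green x) v) = f x"
proof -
  have "(\<Sum>v\<in>verts G. f v * lap (green x) v) =
    (\<Sum>v\<in>verts G. (if v = x then f v else 0) - (if v = q then f v else 0))"
    using assms by (intro sum.cong refl) (simp add: lap_green)
  also have "\<dots> = f x" using assms root by (simp add: sum_subtractf)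
  finally show ?thesis .
qed

text \<open>Reciprocity, from the self-adjointness of the Laplacian applied to two Green
  functions.\<close>

lemma green_commute: "x \<in> verts G \<Longrightarrow> y \<in> verts G \<Longrightarrow> green x y = green y x"
  using sum_mult_lap_green[of y "green x"] sum_mult_lap_green[of x "green y"]
    sum_mult_lap_commute[of "green x" "green y"] by simp

text \<open>Otherwise \<open>green x\<close> would vanish at \<open>q\<close> and \<open>x\<close>
  and be harmonic elsewhere, hence be zero, against its Laplacian 1 at \<open>x\<close>.\<close>

lemma green_diag_nonzero:
  assumes "x \<in> verts G" "x \<noteq> q" shows "green x x \<noteq> 0"
proof
  assume 0: "green x x = 0"
  have "green x v = 0" if "v \<in> verts G" for v
    by (rule lap_zero_imp_zero[OF root _ _ that]) (use 0 assms lap_green in auto)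
  then have "lap (green x) x = 0" unfolding lap_def using opp_in_verts assms(1) by simp
  then show False using lap_green[of x x] assms by simp
qed

text \<open>Grounding \<open>x\<close> besides \<open>q\<close> is a Schur complement step: up to
  factors, the Green function grounded at \<open>{q, x}\<close> is \<open>green y\<close> corrected
  by a multiple of \<open>green x\<close>.\<close>

lemma rooted_count_triple:
  assumes "x \<in> verts G" "y \<in> verts G" "x \<noteq> q" "y \<noteq> q" "x \<noteq> y"
  shows "rooted_count {q, x, y} = rooted_count {q} * (green x x * green y y - (green x y)\<^sup>2)"
proof -
  define h where "h = rooted_count_conn {q, x} y"
  \<comment> \<open>The coefficients make \<open>k\<close> vanish at \<open>x\<close> as well as at
    \<open>q\<close>; those of \<open>\<phi>\<close> cancel the Laplacian at \<open>y\<close>, so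
    \<open>\<phi>\<close> is harmonic off \<open>q\<close> and \<open>x\<close>.\<close>
  define k where "k = (\<lambda>v. green x x * green y v + (- green y x) * green x v)"
  define \<phi> where "\<phi> = (\<lambda>v. green x x * h v + (- rooted_count {q, x}) * k v)"
  have h0: "h q = 0" "h x = 0" using assms by (auto simp: h_def rooted_count_conn_root)
  have lap_h: "lap h v = rooted_count {q, x} * of_bool (v = y)"
    if "v \<in> verts G" "v \<noteq> q" "v \<noteq> x" for v
    using lap_rooted_count_conn_self[of y "{q, x}"] lap_rooted_count_conn_other[of y v "{q, x}"]
      assms that by (cases "v = y") (auto simp: h_def)
  have lap_k: "lap k v = green x x * of_bool (v = y)" if "v \<in> verts G" "v \<noteq> q" "v \<noteq> x" for v
    using that assms unfolding k_def lap_linear by (simp add: lap_green)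
  have "\<phi> v * lap \<phi> v = 0" if "v \<in> verts G" for v
  proof (cases "v = q \<or> v = x")
    case True
    then have "\<phi> v = 0" using h0 by (auto simp: \<phi>_def k_def)
    then show ?thesis by simp
  next
    case False
    then have "lap \<phi> v = 0" using that unfolding \<phi>_def lap_linear by (simp add: lap_h lap_k)
    then show ?thesis by simp
  qed
  moreover have "\<phi> q = 0" using h0 by (simp add: \<phi>_def k_def)
  ultimately have "\<phi> y = 0" using lap_zero_imp_zero[OF root] assms by blast
  \<comment> \<open>\<open>rooted_count {q, x}\<close> contains the factor \<open>green x x\<close>,
    which is nonzero and can be cancelled.\<close>
  then have "green x x * h y = green x x * (rooted_count {q} * k y)"
    by (simp add: \<phi>_def rooted_count_pair[OF assms(3)])
  then have "h y = rooted_count {q} * k y" using green_diag_nonzero assms by simp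
  moreover have "h y = rooted_count {q, x, y}"
    by (simp add: h_def rooted_count_conn_self insert_commute)
  ultimately show ?thesis
    using green_commute[of x y] assms by (simp add: k_def power2_eq_square)
qed

text \<open>The edge terms are two by two principal minors of the Green matrix. They vanish at edges
  incident to \<open>q\<close>, so the sum extends to all arcs.\<close>

lemma card_two_forests_green:
  "real (card (two_forests q)) = rooted_count {q} * ((\<Sum>x\<in>verts G. green x x)
    - (\<Sum>e\<in>arcs G. green (tail G e) (tail G e) * green (head G e) (head G e)
        - (green (tail G e) (head G e))\<^sup>2))"
proof -
  have "(\<Sum>x\<in>verts G - {q}. rooted_count {q, x}) = (\<Sum>x\<in>verts G. rooted_count {q} * green x x)"
    using root by (simp add: sum.remove[of "verts G" q] rooted_count_pair)
  moreover have "(\<Sum>e | e \<in> arcs G \<and> tail G e \<noteq> q \<and> head G e \<noteq> q. rooted_count {q, tail G e, head G e})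
    = (\<Sum>e\<in>arcs G. rooted_count {q} * (green (tail G e) (tail G e) * green (head G e) (head G e)
        - (green (tail G e) (head G e))\<^sup>2))"
  proof (rule sum.mono_neutral_cong_left)
    show "\<forall>e\<in>arcs G - {e. e \<in> arcs G \<and> tail G e \<noteq> q \<and> head G e \<noteq> q}.
      rooted_count {q} * (green (tail G e) (tail G e) * green (head G e) (head G e)
        - (green (tail G e) (head G e))\<^sup>2) = 0"
    proof
      fix e assume "e \<in> arcs G - {e. e \<in> arcs G \<and> tail G e \<noteq> q \<and> head G e \<noteq> q}"
      then have "tail G e = q \<or> head G e = q" by blast
      then show "rooted_count {q} * (green (tail G e) (tail G e) * green (head G e) (head G e)
        - (green (tail G e) (head G e))\<^sup>2) = 0"
        by (elim disjE) simp_all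
    qed
  qed (use no_loops in \<open>auto intro!: rooted_count_triple\<close>)
  ultimately show ?thesis
    unfolding card_two_forests[OF root] by (simp add: sum_distrib_left right_diff_distrib)
qed

text \<open>Shown to be the effective resistance in \<open>effective_resistance_eq_green\<close>;
  for \<open>y = q\<close> it reduces to \<open>green x x\<close>.\<close>

definition green_resistance :: "'a \<Rightarrow> 'a \<Rightarrow> real" where
  "green_resistance x y = green x x + green y y - 2 * green x y"

lemma sum_green_diag_diff:
  "(\<Sum>e\<in>arcs G. (green (head G e) (head G e) - green (tail G e) (tail G e))\<^sup>2) =
    2 * (\<Sum>x\<in>verts G. green x x)
    - (\<Sum>e\<in>arcs G. green_resistance (head G e) (tail G e)
        * (green (head G e) (head G e) + green (tail G e) (tail G e)))"
proof -
  have diag: "(\<Sum>e\<in>incident v. green v v - green v (opp e v)) = of_bool (v \<noteq> q)" if "v \<in> verts G" for v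
    using lap_green[of v v] that by (auto simp: lap_def)
  \<comment> \<open>Each edge is met once from each of its two ends.\<close>
  have inc: "(\<Sum>v\<in>verts G. \<Sum>e\<in>incident v. \<psi> v (opp e v)) =
      (\<Sum>e\<in>arcs G. \<psi> (tail G e) (head G e) + \<psi> (head G e) (tail G e))" for \<psi> :: "'a \<Rightarrow> 'a \<Rightarrow> real"
  proof -
    have "(\<Sum>e\<in>incident v. \<psi> v (opp e v)) = (\<Sum>e\<in>arcs G.
      (if v = tail G e then \<psi> (tail G e) (head G e) else 0)
      + (if v = head G e then \<psi> (head G e) (tail G e) else 0))" for v
      by (rule sum.mono_neutral_cong_left) (use no_loops in \<open>auto simp: incident_def opp_def\<close>)
    then have "(\<Sum>v\<in>verts G. \<Sum>e\<in>incident v. \<psi> v (opp e v)) = (\<Sum>e\<in>arcs G. \<Sum>v\<in>verts G.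
      (if v = tail G e then \<psi> (tail G e) (head G e) else 0)
      + (if v = head G e then \<psi> (head G e) (tail G e) else 0))"
      by (simp only:) (rule sum.swap)
    also have "\<dots> = (\<Sum>e\<in>arcs G. \<psi> (tail G e) (head G e) + \<psi> (head G e) (tail G e))"
      by (intro sum.cong refl) (simp add: sum.distrib)
    finally show ?thesis .
  qed
  \<comment> \<open>The equation \<open>diag\<close> is weighted by \<open>2 * green v v\<close>;
    the weight is zero at \<open>q\<close>, the one vertex where \<open>diag\<close> does not give
    1.\<close>
  have "2 * (\<Sum>x\<in>verts G. green x x) =
      (\<Sum>v\<in>verts G. \<Sum>e\<in>incident v. 2 * green v v * (green v v - green v (opp e v)))"
    unfolding sum_distrib_left
  proof (intro sum.cong refl)
    fix v assume "v \<in> verts G"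
    then show "2 * green v v = (\<Sum>e\<in>incident v. 2 * green v v * (green v v - green v (opp e v)))"
      unfolding sum_distrib_left[symmetric] by (cases "v = q") (simp_all add: diag)
  qed
  also have "\<dots> = (\<Sum>e\<in>arcs G. (green (head G e) (head G e) - green (tail G e) (tail G e))\<^sup>2
      + green_resistance (head G e) (tail G e)
        * (green (head G e) (head G e) + green (tail G e) (tail G e)))"
    unfolding inc[of "\<lambda>v w. 2 * green v v * (green v v - green v w)"]
  proof (intro sum.cong refl)
    fix e assume "e \<in> arcs G"
    then have s: "green (tail G e) (head G e) = green (head G e) (tail G e)"
      by (intro green_commute) auto
    show "2 * green (tail G e) (tail G e) * (green (tail G e) (tail G e) - green (tail G e) (head G e))
      + 2 * green (head G e) (head G e) * (green (head G e) (head G e) - green (head G e) (tail G e)) =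
      (green (head G e) (head G e) - green (tail G e) (tail G e))\<^sup>2
      + green_resistance (head G e) (tail G e)
        * (green (head G e) (head G e) + green (tail G e) (tail G e))"
      unfolding s green_resistance_def power2_eq_square by algebra
  qed
  finally show ?thesis by (simp add: sum.distrib)
qed

lemma two_forests_ratio:
  "real (card (two_forests q)) / rooted_count {q} =
    3 / 4 * (\<Sum>e\<in>arcs G. (green_resistance (head G e) q - green_resistance (tail G e) q)\<^sup>2)
    + 1 / 4 * (\<Sum>e\<in>arcs G. (green_resistance (head G e) (tail G e))\<^sup>2)"
proof -
  let ?a = "\<lambda>e. green (head G e) (head G e)" and ?b = "\<lambda>e. green (tail G e) (tail G e)"
  let ?r = "\<lambda>e. green_resistance (head G e) (tail G e)"
  \<comment> \<open>The mixed value is eliminated from the minor: it equals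
    \<open>(?a e + ?b e - ?r e) / 2\<close>.\<close>
  have "(\<Sum>e\<in>arcs G. ?b e * ?a e - (green (tail G e) (head G e))\<^sup>2) =
    (\<Sum>e\<in>arcs G. 1 / 2 * (?r e * (?a e + ?b e)) - 1 / 4 * (?a e - ?b e)\<^sup>2 - 1 / 4 * (?r e)\<^sup>2)"
  proof (intro sum.cong refl)
    fix e assume "e \<in> arcs G"
    then have s: "green (tail G e) (head G e) = green (head G e) (tail G e)"
      by (intro green_commute) auto
    show "?b e * ?a e - (green (tail G e) (head G e))\<^sup>2 =
      1 / 2 * (?r e * (?a e + ?b e)) - 1 / 4 * (?a e - ?b e)\<^sup>2 - 1 / 4 * (?r e)\<^sup>2"
      unfolding s green_resistance_def power2_eq_square by (simp add: field_simps)
  qed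
  also have "\<dots> = 1 / 2 * (\<Sum>e\<in>arcs G. ?r e * (?a e + ?b e)) - 1 / 4 * (\<Sum>e\<in>arcs G. (?a e - ?b e)\<^sup>2)
      - 1 / 4 * (\<Sum>e\<in>arcs G. (?r e)\<^sup>2)"
    by (simp only: sum_subtractf sum_distrib_left)
  finally have minors: "(\<Sum>e\<in>arcs G. ?b e * ?a e - (green (tail G e) (head G e))\<^sup>2) = \<dots>" .
  have "real (card (two_forests q)) / rooted_count {q} = (\<Sum>x\<in>verts G. green x x)
      - (\<Sum>e\<in>arcs G. ?b e * ?a e - (green (tail G e) (head G e))\<^sup>2)"
    using spanning_tree_exists by (simp add: card_two_forests_green)
  \<comment> \<open>By \<open>sum_green_diag_diff\<close>, the sum of \<open>green x x\<close> minus
    half the sum of \<open>?r e * (?a e + ?b e)\<close> is half the sum of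
    \<open>(?a e - ?b e)\<^sup>2\<close>; the quarter from the minors makes it 3/4.\<close>
  then have "real (card (two_forests q)) / rooted_count {q} =
    3 / 4 * (\<Sum>e\<in>arcs G. (?a e - ?b e)\<^sup>2) + 1 / 4 * (\<Sum>e\<in>arcs G. (?r e)\<^sup>2)"
    using minors sum_green_diag_diff by linarith
  then show ?thesis by (simp add: green_resistance_def)
qed

end

section \<open>The pseudoinverse of the Laplacian\<close>

lemma mat_mult_on_assoc:
  "mat_mult_on V (mat_mult_on V A B) C u v = mat_mult_on V A (mat_mult_on V B C) u v"
  unfolding mat_mult_on_def sum_distrib_left sum_distrib_right
  by (subst sum.swap) (simp add: mult.assoc)

lemma mat_mult_on_cong:
  "(\<And>w. w \<in> V \<Longrightarrow> A u w = A' u w) \<Longrightarrow> (\<And>w. w \<in> V \<Longrightarrow> B w v = B' w v) \<Longrightarrow>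
    mat_mult_on V A B u v = mat_mult_on V A' B' u v"
  unfolding mat_mult_on_def by (rule sum.cong) auto

text \<open>Penrose's argument: \<open>A X = (A Y) (A X)\<close>, by symmetry of both factors the
  transpose of \<open>(A X) (A Y) = A Y\<close>, which is symmetric; likewise for
  \<open>X A\<close>. Then \<open>X = X A X = Y A X = Y A Y = Y\<close>.\<close>

lemma is_pseudoinverse_on_unique:
  assumes X: "is_pseudoinverse_on V A X" and Y: "is_pseudoinverse_on V A Y"
  shows "X = Y"
proof -
  let ?m = "mat_mult_on V"
  note X = X[unfolded is_pseudoinverse_on_def] and Y = Y[unfolded is_pseudoinverse_on_def]
  have transp: "?m B C u v = ?m C B v u"
    if "\<And>w. w \<in> V \<Longrightarrow> B u w = B w u" "\<And>w. w \<in> V \<Longrightarrow> C w v = C v w" for B C u v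
    using that unfolding mat_mult_on_def by (intro sum.cong refl) (simp add: mult.commute)
  have AX: "?m A X u v = ?m A Y u v" if "u \<in> V" "v \<in> V" for u v
  proof -
    have "?m A X u v = ?m (?m (?m A Y) A) X u v" by (rule mat_mult_on_cong) (use Y that in auto)
    also have "\<dots> = ?m (?m A Y) (?m A X) u v" by (rule mat_mult_on_assoc)
    also have "\<dots> = ?m (?m A X) (?m A Y) v u" by (rule transp) (use X Y that in blast)+
    also have "\<dots> = ?m (?m (?m A X) A) Y v u" by (rule mat_mult_on_assoc[symmetric])
    also have "\<dots> = ?m A Y v u" by (rule mat_mult_on_cong) (use X that in auto)
    also have "\<dots> = ?m A Y u v" using Y that by blast
    finally show ?thesis .
  qed
  have XA: "?m X A u v = ?m Y A u v" if "u \<in> V" "v \<in> V" for u v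
  proof -
    have "?m X A u v = ?m X (?m A (?m Y A)) u v"
      by (rule mat_mult_on_cong) (use Y that in \<open>auto simp: mat_mult_on_assoc[symmetric]\<close>)
    also have "\<dots> = ?m (?m X A) (?m Y A) u v" by (rule mat_mult_on_assoc[symmetric])
    also have "\<dots> = ?m (?m Y A) (?m X A) v u" by (rule transp) (use X Y that in blast)+
    also have "\<dots> = ?m Y (?m A (?m X A)) v u" by (rule mat_mult_on_assoc)
    also have "\<dots> = ?m Y A v u"
      by (rule mat_mult_on_cong) (use X that in \<open>auto simp: mat_mult_on_assoc[symmetric]\<close>)
    also have "\<dots> = ?m Y A u v" using Y that by blast
    finally show ?thesis .
  qed
  show ?thesis
  proof (intro ext)
    fix u v
    show "X u v = Y u v"
    proof (cases "u \<in> V \<and> v \<in> V")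
      case True
      then have "X u v = ?m (?m X A) X u v" using X by simp
      also have "\<dots> = ?m (?m Y A) X u v" by (rule mat_mult_on_cong) (use XA True in auto)
      also have "\<dots> = ?m Y (?m A X) u v" by (rule mat_mult_on_assoc)
      also have "\<dots> = ?m Y (?m A Y) u v" by (rule mat_mult_on_cong) (use AX True in auto)
      also have "\<dots> = ?m (?m Y A) Y u v" by (rule mat_mult_on_assoc[symmetric])
      also have "\<dots> = Y u v" using Y True by simp
      finally show ?thesis .
    next
      case False
      then show ?thesis using X Y by auto
    qed
  qed
qed

lemma pseudoinverse_on_eqI: "is_pseudoinverse_on V A X \<Longrightarrow> pseudoinverse_on V A = X"
  unfolding pseudoinverse_on_def by (blast intro: is_pseudoinverse_on_unique)

section \<open>The Laplacian matrix as an operator\<close>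

context loopfree_multigraph
begin

text \<open>The incidence matrix times its transpose. The absence of loops matters on the diagonal:
  a loop would add two to the degrees and nothing to the sum.\<close>

lemma laplacian_eq_sum:
  "laplacian G v w = (\<Sum>e\<in>arcs G. (of_bool (tail G e = v) - of_bool (head G e = v))
    * (of_bool (tail G e = w) - of_bool (head G e = w)))"
proof (cases "v = w")
  case True
  have "(\<Sum>e\<in>arcs G. (of_bool (tail G e = v) - of_bool (head G e = v))
    * (of_bool (tail G e = v) - of_bool (head G e = v))) =
    (\<Sum>e\<in>arcs G. of_bool (head G e = v) + of_bool (tail G e = v) :: real)"
    using no_loops by (intro sum.cong) auto
  then show ?thesis
    using True by (simp add: laplacian_def in_degree_def out_degree_def in_arcs_def out_arcs_def
        sum.distrib sum_of_bool_eq Int_def)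
next
  case False
  have "(\<Sum>e\<in>arcs G. (of_bool (tail G e = v) - of_bool (head G e = v))
    * (of_bool (tail G e = w) - of_bool (head G e = w))) =
    (\<Sum>e\<in>arcs G. - of_bool ({tail G e, head G e} = {v, w}) :: real)"
    using no_loops False by (intro sum.cong) (auto simp: doubleton_eq_iff)
  then show ?thesis
    using False by (simp add: laplacian_def sum_negf sum_of_bool_eq Int_def)
qed

lemma laplacian_commute: "laplacian G v w = laplacian G w v"
  unfolding laplacian_eq_sum by (simp add: mult.commute)

lemma sum_laplacian_mult: "(\<Sum>w\<in>verts G. laplacian G v w * f w) = lap f v"
proof -
  have "(\<Sum>w\<in>verts G. laplacian G v w * f w) = (\<Sum>e\<in>arcs G. \<Sum>w\<in>verts G.
    (of_bool (tail G e = v) - of_bool (head G e = v)) *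
    ((if w = tail G e then f w else 0) - (if w = head G e then f w else 0)))"
    unfolding laplacian_eq_sum sum_distrib_right
    by (subst sum.swap) (auto intro!: sum.cong)
  also have "\<dots> = lap f v"
    unfolding lap_alt sum_distrib_left[symmetric]
    by (intro sum.cong refl) (simp add: sum_subtractf)
  finally show ?thesis .
qed

lemma lap_cong:
  assumes "v \<in> verts G" "\<And>w. w \<in> verts G \<Longrightarrow> f w = g w"
  shows "lap f v = lap g v"
  unfolding lap_def using assms opp_in_verts by (intro sum.cong) auto

end

context connected_multigraph
begin

text \<open>Centring the rows and columns of the Green function turns it into the pseudoinverse; the values
  \<open>g(x,x) + g(y,y) - 2 g(x,y)\<close> are not affected.\<close>

definition centred_green :: "'a \<Rightarrow> 'a \<Rightarrow> real" where
  "centred_green u v = (if u \<in> verts G \<and> v \<in> verts G then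
     green u v - (\<Sum>w\<in>verts G. green w u) / card (verts G) - (\<Sum>w\<in>verts G. green w v) / card (verts G)
       + (\<Sum>w\<in>verts G. \<Sum>z\<in>verts G. green z w) / (card (verts G))\<^sup>2 else 0)"

lemma card_verts_pos: "card (verts G) > 0"
  using root by (auto simp: card_gt_0_iff)

lemma centred_green_commute: "centred_green u v = centred_green v u"
  by (simp add: centred_green_def green_commute)

text \<open>The mean of the Green functions has Laplacian \<open>1 / n\<close>, lowered by 1 at
  \<open>q\<close>, with \<open>n\<close> vertices; subtracting it cancels the \<open>- 1\<close> of
  \<open>green v\<close> at \<open>q\<close> and leaves \<open>- 1 / n\<close>.\<close>

lemma lap_centred_green:
  assumes "u \<in> verts G" "v \<in> verts G"
  shows "lap (\<lambda>w. centred_green w v) u = of_bool (u = v) - 1 / card (verts G)"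
proof -
  let ?n = "real (card (verts G))"
  define c where "c = (\<Sum>w\<in>verts G. \<Sum>z\<in>verts G. green z w) / ?n\<^sup>2 - (\<Sum>w\<in>verts G. green w v) / ?n"
  \<comment> \<open>The factors 1 give the function the shape of \<open>lap_linear\<close>;
    \<open>c\<close> collects the terms that do not depend on \<open>w\<close>.\<close>
  have "lap (\<lambda>w. centred_green w v) u =
    lap (\<lambda>w. 1 * (1 * green v w + (- 1 / ?n) * (\<Sum>z\<in>verts G. green z w)) + c * 1) u"
    using assms by (intro lap_cong) (auto simp: centred_green_def c_def green_commute)
  also have "\<dots> = lap (green v) u - lap (\<lambda>w. \<Sum>z\<in>verts G. green z w) u / ?n"
    unfolding lap_linear by (simp add: lap_def)
  also have "lap (\<lambda>w. \<Sum>z\<in>verts G. green z w) u = (\<Sum>z\<in>verts G. lap (green z) u)"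
    unfolding lap_def sum_subtractf[symmetric] by (rule sum.swap)
  also have "\<dots> = (\<Sum>z\<in>verts G. of_bool (u = z) - of_bool (u = q))"
    using assms by (intro sum.cong refl lap_green)
  also have "\<dots> = 1 - ?n * of_bool (u = q)"
    using assms(1) by (simp add: sum_subtractf of_bool_def)
  finally show ?thesis
    using assms card_verts_pos by (auto simp: lap_green diff_divide_distrib)
qed

lemma sum_centred_green:
  assumes "v \<in> verts G" shows "(\<Sum>w\<in>verts G. centred_green w v) = 0"
proof -
  let ?n = "real (card (verts G))"
  have "(\<Sum>w\<in>verts G. centred_green w v) = (\<Sum>w\<in>verts G. green w v
    - (\<Sum>z\<in>verts G. green z w) / ?n - (\<Sum>w\<in>verts G. green w v) / ?n
       + (\<Sum>w\<in>verts G. \<Sum>z\<in>verts G. green z w) / ?n\<^sup>2)"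
    using assms by (intro sum.cong) (auto simp: centred_green_def)
  also have "\<dots> = 0"
    using card_verts_pos
    by (simp add: sum.distrib sum_subtractf sum_divide_distrib[symmetric] power2_eq_square)
  finally show ?thesis .
qed

text \<open>Both products are the orthogonal projection \<open>?P\<close> onto vectors with zero
  sum. It fixes the Laplacian and \<open>centred_green\<close> because their columns sum to
  zero.\<close>

lemma is_pseudoinverse_centred_green:
  "is_pseudoinverse_on (verts G) (laplacian G) centred_green"
proof -
  let ?n = "real (card (verts G))" and ?m = "mat_mult_on (verts G)"
  let ?P = "\<lambda>u v. of_bool (u = v) - 1 / ?n :: real"
  have LX: "?m (laplacian G) centred_green u v = ?P u v" if "u \<in> verts G" "v \<in> verts G" for u v
    using that by (simp add: mat_mult_on_def sum_laplacian_mult lap_centred_green)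
  have XL: "?m centred_green (laplacian G) u v = ?P u v" if "u \<in> verts G" "v \<in> verts G" for u v
  proof -
    have "?m centred_green (laplacian G) u v = ?m (laplacian G) centred_green v u"
      unfolding mat_mult_on_def
      by (intro sum.cong refl) (simp add: laplacian_commute[of _ v] centred_green_commute[of u])
    then show ?thesis using LX[OF that(2,1)] by auto
  qed
  have P: "?m ?P B u v = B u v" if "u \<in> verts G" "(\<Sum>w\<in>verts G. B w v) = 0" for B u v
  proof -
    have "?m ?P B u v = (\<Sum>w\<in>verts G. (if w = u then B w v else 0) - 1 / ?n * B w v)"
      unfolding mat_mult_on_def by (intro sum.cong refl) (auto simp: algebra_simps)
    also have "\<dots> = B u v"
      using that by (simp add: sum_subtractf sum_distrib_left[symmetric] sum_divide_distrib[symmetric])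
    finally show ?thesis .
  qed
  have L0: "(\<Sum>w\<in>verts G. laplacian G w v) = 0" for v
    using sum_laplacian_mult[of v "\<lambda>_. 1"] by (simp add: laplacian_commute[of _ v] lap_def)
  have "?m (?m (laplacian G) centred_green) (laplacian G) u v = laplacian G u v"
    if "u \<in> verts G" "v \<in> verts G" for u v
  proof -
    have "?m (?m (laplacian G) centred_green) (laplacian G) u v = ?m ?P (laplacian G) u v"
      by (rule mat_mult_on_cong) (use LX that in auto)
    then show ?thesis using P[of u "laplacian G" v, OF that(1) L0] by simp
  qed
  moreover have "?m (?m centred_green (laplacian G)) centred_green u v = centred_green u v"
    if "u \<in> verts G" "v \<in> verts G" for u v
  proof -
    have "?m (?m centred_green (laplacian G)) centred_green u v = ?m ?P centred_green u v"
      by (rule mat_mult_on_cong) (use XL that in auto)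
    then show ?thesis using P[of u centred_green v, OF that(1) sum_centred_green[OF that(2)]] by simp
  qed
  ultimately show ?thesis
    unfolding is_pseudoinverse_on_def using LX XL by (auto simp: centred_green_def)
qed

lemma effective_resistance_eq_green:
  assumes "x \<in> verts G" "y \<in> verts G"
  shows "effective_resistance G x y = green_resistance x y"
proof -
  let ?X = centred_green
  have in1: "(\<Sum>v\<in>verts G. (of_bool (u = x) - of_bool (u = y)) * ?X u v * (of_bool (v = x) - of_bool (v = y))) =
    (of_bool (u = x) - of_bool (u = y)) * (?X u x - ?X u y)" for u
  proof -
    have "(\<Sum>v\<in>verts G. (of_bool (u = x) - of_bool (u = y)) * ?X u v * (of_bool (v = x) - of_bool (v = y))) =
      (of_bool (u = x) - of_bool (u = y)) * (\<Sum>v\<in>verts G. (if v = x then ?X u v else 0) - (if v = y then ?X u v else 0))"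
      unfolding sum_distrib_left by (intro sum.cong refl) auto
    then show ?thesis using assms by (simp add: sum_subtractf)
  qed
  have "effective_resistance G x y = (\<Sum>u\<in>verts G. (of_bool (u = x) - of_bool (u = y)) * (?X u x - ?X u y))"
    unfolding effective_resistance_def Let_def
      pseudoinverse_on_eqI[OF is_pseudoinverse_centred_green] in1 ..
  also have "\<dots> = (\<Sum>u\<in>verts G. (if u = x then ?X u x - ?X u y else 0) - (if u = y then ?X u x - ?X u y else 0))"
    by (intro sum.cong refl) auto
  also have "\<dots> = ?X x x - ?X x y - (?X y x - ?X y y)"
    using assms by (simp add: sum_subtractf)
  also have "\<dots> = green_resistance x y"
    using assms green_commute[of y x] by (simp add: centred_green_def green_resistance_def)
  finally show ?thesis .
qed

end

section \<open>Translation from subgraphs to edge sets\<close>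

context wf_digraph
begin

definition spanning_subgraph :: "'b set \<Rightarrow> ('a, 'b) pre_digraph" where
  "spanning_subgraph S = \<lparr>verts = verts G, arcs = S, tail = tail G, head = head G\<rparr>"

lemma spanning_subgraph_simps [simp]:
  "verts (spanning_subgraph S) = verts G" "arcs (spanning_subgraph S) = S"
  "tail (spanning_subgraph S) = tail G" "head (spanning_subgraph S) = head G"
  by (simp_all add: spanning_subgraph_def)

lemma wf_spanning_subgraph: "S \<subseteq> arcs G \<Longrightarrow> wf_digraph (spanning_subgraph S)"
  by unfold_locales auto

text \<open>Spanning fixes the vertices and compatibility fixes the tail and head maps, so a
  spanning subgraph is determined by its arcs.\<close>

lemma card_spanning:
  "card {T. spanning T G \<and> P T} = card {S. S \<subseteq> arcs G \<and> P (spanning_subgraph S)}"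
proof (rule bij_betw_same_card[of arcs], rule bij_betw_byWitness[where f' = spanning_subgraph])
  have eq: "spanning_subgraph (arcs T) = T" if "spanning T G" for T
    using that by (simp add: spanning_subgraph_def spanning_def subgraph_def compatible_def)
  show "\<forall>T\<in>{T. spanning T G \<and> P T}. spanning_subgraph (arcs T) = T" using eq by blast
  show "\<forall>S\<in>{S. S \<subseteq> arcs G \<and> P (spanning_subgraph S)}. arcs (spanning_subgraph S) = S" by simp
  show "arcs ` {T. spanning T G \<and> P T} \<subseteq> {S. S \<subseteq> arcs G \<and> P (spanning_subgraph S)}"
    using eq by (auto simp: spanning_def subgraph_def)
  show "spanning_subgraph ` {S. S \<subseteq> arcs G \<and> P (spanning_subgraph S)} \<subseteq> {T. spanning T G \<and> P T}"
    using wf_spanning_subgraph wf_digraph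
    by (auto simp: spanning_def subgraph_def compatible_def)
qed

lemma conn_in_verts:
  assumes "conn S u v" "S \<subseteq> arcs G" "u \<in> verts G" shows "v \<in> verts G"
  using assms(1) by (induction rule: conn_induct) (use assms in auto)

text \<open>Reachability holds only between vertices, whereas \<open>conn\<close> is reflexive on
  the whole type; hence the conjunct on \<open>u\<close>.\<close>

lemma reachable_mk_symmetric_iff_conn:
  assumes "S \<subseteq> arcs G"
  shows "u \<rightarrow>\<^sup>*\<^bsub>with_proj (mk_symmetric (spanning_subgraph S))\<^esub> v \<longleftrightarrow> u \<in> verts G \<and> conn S u v"
proof -
  interpret T: wf_digraph "spanning_subgraph S" using assms by (rule wf_spanning_subgraph)
  interpret M: pair_wf_digraph "mk_symmetric (spanning_subgraph S)" ..
  have dom: "(a, b) \<in> parcs (mk_symmetric (spanning_subgraph S)) \<longleftrightarrow>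
    (\<exists>e\<in>S. (a = tail G e \<and> b = head G e) \<or> (a = head G e \<and> b = tail G e))" for a b
    by (auto simp: parcs_mk_symmetric)
  show ?thesis
  proof
    assume L: "u \<rightarrow>\<^sup>*\<^bsub>with_proj (mk_symmetric (spanning_subgraph S))\<^esub> v"
    then have "u \<in> verts G" by (auto dest: M.reachable_in_verts)
    moreover from L have "conn S u v"
    proof (induction rule: M.reachable_induct)
      case (step a b)
      then obtain e where "e \<in> S" "(a = tail G e \<and> b = head G e) \<or> (a = head G e \<and> b = tail G e)"
        using dom[of a b] by auto
      then have "conn S a b" using conn_arc[of e S] conn_sym by blast
      then show ?case using step by (blast intro: conn_trans)
    qed simp
    ultimately show "u \<in> verts G \<and> conn S u v" ..
  next
    assume R: "u \<in> verts G \<and> conn S u v"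
    then have "conn S u v" ..
    then show "u \<rightarrow>\<^sup>*\<^bsub>with_proj (mk_symmetric (spanning_subgraph S))\<^esub> v"
    proof (induction rule: conn_induct)
      case base
      then show ?case using R by simp
    next
      case (step a b e)
      then have "(a, b) \<in> parcs (mk_symmetric (spanning_subgraph S))" using dom by blast
      then show ?case using step(4) by (auto intro: M.reachable_adj_trans)
    qed
  qed
qed

lemma connected_spanning_subgraph_iff:
  assumes "S \<subseteq> arcs G" "verts G \<noteq> {}"
  shows "Digraph_Component.connected (spanning_subgraph S) \<longleftrightarrow> (\<forall>u\<in>verts G. \<forall>v\<in>verts G. conn S u v)"
  using assms reachable_mk_symmetric_iff_conn[OF assms(1)]
  by (simp add: Digraph_Component.connected_def strongly_connected_def)

lemma graph_components_spanning_subgraph: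
  assumes "S \<subseteq> arcs G"
  shows "graph_components (spanning_subgraph S) = conn_class S ` verts G"
proof -
  interpret T: wf_digraph "spanning_subgraph S" using assms by (rule wf_spanning_subgraph)
  interpret M: pair_wf_digraph "mk_symmetric (spanning_subgraph S)" ..
  have "M.scc_of u = conn_class S u" if "u \<in> verts G" for u
    using that conn_in_verts[OF _ assms that] reachable_mk_symmetric_iff_conn[OF assms] conn_sym
    by (auto simp: M.scc_of_def conn_class_def)
  then show ?thesis by (simp add: graph_components_def M.sccs_verts_conv_scc_of)
qed

lemma card_graph_components_eq_2_iff:
  assumes "S \<subseteq> arcs G" "q \<in> verts G"
  shows "card (graph_components (spanning_subgraph S)) = 2 \<longleftrightarrow>
    (\<exists>x\<in>verts G. \<not> conn S q x \<and> (\<forall>v\<in>verts G. conn S v q \<or> conn S v x))"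
    (is "card ?C = 2 \<longleftrightarrow> ?R")
proof
  assume "card ?C = 2"
  then obtain A B where AB: "A \<noteq> B" "conn_class S ` verts G = {A, B}"
    by (auto simp: card_2_iff graph_components_spanning_subgraph[OF assms(1)])
  then obtain x where x: "x \<in> verts G" "conn_class S x \<noteq> conn_class S q"
    by (metis imageE insertI1 insertI2)
  have "conn_class S v = A \<or> conn_class S v = B" if "v \<in> verts G" for v
    using imageI[OF that, of "conn_class S"] unfolding AB(2) by simp
  then have "conn_class S v = conn_class S q \<or> conn_class S v = conn_class S x" if "v \<in> verts G" for v
    using that x assms(2) by metis
  then show ?R unfolding conn_iff_class using x by metis
next
  assume ?R
  then obtain x where x: "x \<in> verts G" "conn_class S x \<noteq> conn_class S q"
    "\<And>v. v \<in> verts G \<Longrightarrow> conn_class S v = conn_class S q \<or> conn_class S v = conn_class S x"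
    unfolding conn_iff_class by metis
  then have "?C = {conn_class S q, conn_class S x}"
    using assms by (auto simp: graph_components_spanning_subgraph)
  then show "card ?C = 2" using x(2) by simp
qed

section \<open>Undirected cycles and bridges\<close>

lemma dart_graph_simps [simp]:
  "verts (dart_graph G) = verts G" "arcs (dart_graph G) = arcs G \<times> UNIV"
  "tail (dart_graph G) (e, b) = (if b then tail G e else head G e)"
  "head (dart_graph G) (e, b) = (if b then head G e else tail G e)"
  by (simp_all add: dart_graph_def)

lemma wf_dart_graph: "wf_digraph (dart_graph G)"
  by unfold_locales auto

text \<open>Both darts of an edge touch the same two vertices, so using an edge again, in either
  direction, would revisit the tail of its first dart.\<close>

lemma apath_dart_graph_distinct_edges:
  "pre_digraph.apath (dart_graph G) u p v \<Longrightarrow> distinct (map fst p)"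
proof (induction p arbitrary: u)
  case (Cons d p)
  interpret D: wf_digraph "dart_graph G" by (rule wf_dart_graph)
  obtain e b where d: "d = (e, b)" by (cases d)
  note C = Cons.prems[unfolded D.apath_Cons_iff]
  have "e \<notin> fst ` set p"
  proof
    assume "e \<in> fst ` set p"
    then obtain b' where b': "(e, b') \<in> set p" by auto
    have "D.awalk (head (dart_graph G) d) p v" using C by (simp add: D.apath_def)
    then have "tail (dart_graph G) d \<in> set (D.awalk_verts (head (dart_graph G) d) p)"
      using D.awalk_verts_arc1[OF b', of "head (dart_graph G) d"] D.awalk_verts_arc2[OF _ b']
      by (cases b; cases b') (auto simp: d)
    then show False using C by blast
  qed
  moreover have "distinct (map fst p)" using Cons.IH C by blast
  ultimately show ?case by (simp add: d)
qed simp

lemma awalk_dart_graph_imp_conn: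
  "pre_digraph.awalk (dart_graph G) u p v \<Longrightarrow> conn (fst ` set p) u v"
proof (induction p arbitrary: u)
  case Nil
  then show ?case by (simp add: wf_digraph.awalk_Nil_iff[OF wf_dart_graph])
next
  case (Cons d p)
  obtain e b where d: "d = (e, b)" by (cases d)
  have "conn (fst ` set (d # p)) u (head (dart_graph G) d)"
    using Cons.prems conn_arc[of e "fst ` set (d # p)"]
    by (auto simp: wf_digraph.awalk_Cons_iff[OF wf_dart_graph] d intro: conn_sym)
  moreover have "conn (fst ` set (d # p)) (head (dart_graph G) d) v"
    by (rule conn_mono[OF Cons.IH])
      (use Cons.prems in \<open>auto simp: wf_digraph.awalk_Cons_iff[OF wf_dart_graph]\<close>)
  ultimately show ?case by (rule conn_trans)
qed

lemma conn_imp_reachable_dart_graph: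
  assumes "conn (arcs G) u v" "u \<in> verts G"
  shows "u \<rightarrow>\<^sup>*\<^bsub>dart_graph G\<^esub> v"
  using assms(1)
proof (induction rule: conn_induct)
  interpret D: wf_digraph "dart_graph G" by (rule wf_dart_graph)
  {
    case base
    then show ?case using assms(2) by simp
  next
    case (step a b e)
    have "a \<rightarrow>\<^bsub>dart_graph G\<^esub> b"
      using step(3) D.in_arcs_imp_in_arcs_ends[of "(e, True)"] D.in_arcs_imp_in_arcs_ends[of "(e, False)"]
        step(1) by auto
    then show ?case using step(4) by (rule D.reachable_adj_trans[rotated])
  }
qed

lemma conn_spanning_subgraph [simp]: "pre_digraph.conn (spanning_subgraph S) = conn"
  by (rule ext) (simp add: pre_digraph.conn_def)

lemma forest_set_spanning_subgraph [simp]: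
  "pre_digraph.forest_set (spanning_subgraph S) = forest_set"
  by (rule ext) (simp add: pre_digraph.forest_set_def)

text \<open>A cycle without its first dart is a walk between the ends of that edge which avoids the
  edge, as edges on it are distinct. Conversely, a simple path avoiding \<open>e\<close> between its
  ends closes up with a dart of \<open>e\<close>.\<close>

lemma undirected_forest_iff_arcs: "undirected_forest G \<longleftrightarrow> forest_set (arcs G)"
proof -
  interpret D: wf_digraph "dart_graph G" by (rule wf_dart_graph)
  have "(\<exists>p. undirected_cycle G p) \<longleftrightarrow> (\<exists>e\<in>arcs G. conn (arcs G - {e}) (tail G e) (head G e))"
  proof
    assume "\<exists>p. undirected_cycle G p"
    then obtain p u where p: "D.awalk u p u" "p \<noteq> []" "distinct (map fst p)"
      by (auto simp: undirected_cycle_def D.cycle_def)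
    then obtain e b p' where p': "p = (e, b) # p'" by (metis neq_Nil_conv surj_pair)
    have w: "D.awalk (if b then head G e else tail G e) p' (if b then tail G e else head G e)"
      and e: "e \<in> arcs G"
      using p(1) by (auto simp: p' D.awalk_Cons_iff)
    have "fst ` set p' \<subseteq> arcs G" using w by (auto simp: D.awalk_def)
    moreover have "e \<notin> fst ` set p'" using p(3) by (simp add: p')
    ultimately have "fst ` set p' \<subseteq> arcs G - {e}" by blast
    with awalk_dart_graph_imp_conn[OF w]
    have "conn (arcs G - {e}) (if b then head G e else tail G e) (if b then tail G e else head G e)"
      by (rule conn_mono)
    then have "conn (arcs G - {e}) (tail G e) (head G e)" by (cases b) (auto intro: conn_sym)
    then show "\<exists>e\<in>arcs G. conn (arcs G - {e}) (tail G e) (head G e)" using e by blast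
  next
    assume "\<exists>e\<in>arcs G. conn (arcs G - {e}) (tail G e) (head G e)"
    then obtain e where e: "e \<in> arcs G" "conn (arcs G - {e}) (head G e) (tail G e)"
      using conn_sym by blast
    \<comment> \<open>The path is sought in the graph without \<open>e\<close>, so neither dart of
      \<open>e\<close> can occur on it.\<close>
    let ?H = "spanning_subgraph (arcs G - {e})"
    interpret H: wf_digraph ?H by (rule wf_spanning_subgraph) blast
    interpret DH: wf_digraph "dart_graph ?H" by (rule H.wf_dart_graph)
    have "head G e \<rightarrow>\<^sup>*\<^bsub>dart_graph ?H\<^esub> tail G e"
      using H.conn_imp_reachable_dart_graph[of "head G e" "tail G e"] e by simp
    then obtain p where p: "DH.apath (head G e) p (tail G e)"
      using DH.reachable_apath by blast
    have "distinct (map fst p)" using H.apath_dart_graph_distinct_edges[OF p] .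
    moreover have sub: "set p \<subseteq> (arcs G - {e}) \<times> UNIV" using p by (auto simp: DH.apath_def DH.awalk_def)
    then have "e \<notin> fst ` set p" by auto
    moreover have same: "tail (dart_graph ?H) = tail (dart_graph G)" "head (dart_graph ?H) = head (dart_graph G)"
      by (simp_all add: dart_graph_def fun_eq_iff)
    \<comment> \<open>Apart from membership of arcs and vertices, walks depend only on the tail and
      head maps, which agree; so the path transfers to \<open>G\<close>.\<close>
    have cas: "DH.cas u p v = D.cas u p v" for u p v by (induction p arbitrary: u) (simp_all add: same)
    have av: "DH.awalk_verts u p = D.awalk_verts u p" for u p by (induction p arbitrary: u) (simp_all add: same)
    have "D.awalk (head G e) p (tail G e)" "distinct (D.awalk_verts (head G e) p)"
      using p sub e by (auto simp: DH.apath_def DH.awalk_def D.awalk_def cas av)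
    \<comment> \<open>The path runs from head to tail, so the dart \<open>(e, True)\<close>, from
      tail to head, closes it.\<close>
    then have "D.cycle ((e, True) # p)"
      unfolding D.cycle_def using e by (intro exI[of _ "tail G e"]) (simp add: D.awalk_Cons_iff)
    ultimately have "undirected_cycle G ((e, True) # p)" by (simp add: undirected_cycle_def)
    then show "\<exists>p. undirected_cycle G p" ..
  qed
  then show ?thesis by (auto simp: undirected_forest_def forest_set_def)
qed

lemma undirected_forest_spanning_subgraph_iff:
  assumes "S \<subseteq> arcs G"
  shows "undirected_forest (spanning_subgraph S) \<longleftrightarrow> forest_set S"
  using wf_digraph.undirected_forest_iff_arcs[OF wf_spanning_subgraph[OF assms]] by simp

end

section \<open>Identification of the counts and conclusion\<close>

context connected_multigraph
begin

lemma num_spanning_trees_eq: "real (num_spanning_trees G) = rooted_count {q}"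
proof -
  have "{S. S \<subseteq> arcs G \<and> Digraph_Component.connected (spanning_subgraph S)
      \<and> undirected_forest (spanning_subgraph S)} = rooted_forests {q}"
  proof (intro set_eqI iffI)
    fix S assume "S \<in> {S. S \<subseteq> arcs G \<and> Digraph_Component.connected (spanning_subgraph S)
      \<and> undirected_forest (spanning_subgraph S)}"
    then show "S \<in> rooted_forests {q}"
      using root connected_spanning_subgraph_iff[of S] undirected_forest_spanning_subgraph_iff[of S]
      by (auto simp: rooted_forests_def)
  next
    fix S assume "S \<in> rooted_forests {q}"
    then have S: "S \<subseteq> arcs G" "forest_set S" "\<And>v. v \<in> verts G \<Longrightarrow> conn S v q"
      by (auto simp: rooted_forests_def)
    then have "\<forall>u\<in>verts G. \<forall>v\<in>verts G. conn S u v" by (blast intro: conn_trans conn_sym)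
    then show "S \<in> {S. S \<subseteq> arcs G \<and> Digraph_Component.connected (spanning_subgraph S)
      \<and> undirected_forest (spanning_subgraph S)}"
      using S root connected_spanning_subgraph_iff[of S] undirected_forest_spanning_subgraph_iff[of S]
      by auto
  qed
  then show ?thesis
    by (simp add: num_spanning_trees_def rooted_count_def card_spanning)
qed

lemma num_spanning_2forests_eq: "num_spanning_2forests G = card (two_forests q)"
proof -
  have "{S. S \<subseteq> arcs G \<and> undirected_forest (spanning_subgraph S)
      \<and> card (graph_components (spanning_subgraph S)) = 2} = two_forests q"
    unfolding two_forests_def
    using root card_graph_components_eq_2_iff[OF _ root] undirected_forest_spanning_subgraph_iff
    by blast
  then show ?thesis by (simp add: num_spanning_2forests_def card_spanning)
qed

end

theorem theorem5p7:
  fixes G :: "('v, 'e) pre_digraph" and q :: 'v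
  assumes "fin_digraph G" and "loopfree_digraph G"
    and "Digraph_Component.connected G"
    and "q \<in> verts G"
  shows "real (num_spanning_2forests G) / real (num_spanning_trees G) =
    3 / 4 * (\<Sum>e\<in>arcs G. (effective_resistance G (head G e) q
                            - effective_resistance G (tail G e) q)\<^sup>2)
    + 1 / 4 * (\<Sum>e\<in>arcs G. (effective_resistance G (head G e) (tail G e))\<^sup>2)"
proof -
  interpret fin_digraph G by fact
  interpret loopfree_digraph G by fact
  \<comment> \<open>Viewing \<open>G\<close> as its own spanning subgraph translates its
    connectedness into \<open>conn\<close>.\<close>
  have "spanning_subgraph (arcs G) = G" by (simp add: spanning_subgraph_def)
  then have "Digraph_Component.connected (spanning_subgraph (arcs G))" using assms(3) by (rule ssubst)
  then have "\<forall>u\<in>verts G. \<forall>v\<in>verts G. conn (arcs G) u v"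
    using connected_spanning_subgraph_iff[of "arcs G"] assms(4) by blast
  then interpret connected_multigraph G q
    using assms(4) by unfold_locales auto
  show ?thesis
    unfolding num_spanning_2forests_eq num_spanning_trees_eq two_forests_ratio
    using root by (simp add: effective_resistance_eq_green)
qed

end
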